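(* For any parameter $0<p<1$ there is a probability measure $\mu_p$ on $[0,1]$, absolutely continuous with respect to Lebesgue measure $\lambda$, such that the product measure $m_p\otimes\mu_p$ is invariant for $R$. The probability density function $h_p$ of $\mu_p$ (with respect to $\lambda$) is of bounded variation.
   Context: $\Omega=\{0,1\}^{\mathbb{N}}$ with elements $\omega=(\omega_k)_{k\ge1}$, and $\sigma$ is the left shift on $\Omega$. The Gauss map $T_0:[0,1]\to[0,1]$ is $T_0(0)=0$ and $T_0x=\frac1x \pmod 1$ for $x\ne0$; the R\'enyi map $T_1:[0,1]\to[0,1]$ is $T_1(1)=0$ and $T_1x=\frac1{1-x}\pmod 1$ for $x\neq1$. The map $R:\Omega\times[0,1]\to\Omega\times[0,1]$ is $R(\omega,x)=(\sigma\omega,T_{\omega_1}x)$. $m_p$ is the $(p,1-p)$-Bernoulli measure on $\Omega$ (symbol $0$ has probability $p$, symbol $1$ has probability $1-p$). A density is said to be of bounded variation if it has a version $g$ (equal to it $\lambda$-a.e.) with $\sup\sum_{i=1}^n|g(x_i)-g(x_{i-1})|<\infty$, the supremum being over all $0=x_0<x_1<\dots<x_n=1$. *)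

theory Defs
  imports "HOL-Probability.Probability"
begin

definition gauss_map :: "real \<Rightarrow> real" where
  "gauss_map x = (if x = 0 then 0 else frac (1 / x))"

definition renyi_map :: "real \<Rightarrow> real" where
  "renyi_map x = (if x = 1 then 0 else frac (1 / (1 - x)))"

text \<open>
  The symbols 0 and 1 are represented by \<open>False\<close> and \<open>True\<close>, and the sequence
  \<open>(\<omega>\<^sub>k)\<close> with \<open>k \<ge> 1\<close> by a function on the naturals indexed from 0, so that
  \<open>\<omega> 0\<close> is the first symbol.
\<close>

definition shift :: "(nat \<Rightarrow> bool) \<Rightarrow> nat \<Rightarrow> bool" where
  "shift \<omega> = (\<lambda>k. \<omega> (Suc k))"

definition skew_product :: "(nat \<Rightarrow> bool) \<times> real \<Rightarrow> (nat \<Rightarrow> bool) \<times> real" where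
  "skew_product = (\<lambda>(\<omega>, x). (shift \<omega>, if \<omega> 0 then renyi_map x else gauss_map x))"

text \<open>
  \<^const>\<open>bernoulli_pmf\<close> is parametrised by the probability of \<open>True\<close>, which here is the
  probability \<open>1 - p\<close> of the symbol 1.
\<close>

definition bernoulli_measure :: "real \<Rightarrow> (nat \<Rightarrow> bool) measure" where
  "bernoulli_measure p = (\<Pi>\<^sub>M i\<in>UNIV. measure_pmf (bernoulli_pmf (1 - p)))"

definition unit_lborel :: "real measure" where
  "unit_lborel = restrict_space lborel {0..1}"

definition invariant_measure :: "'a measure \<Rightarrow> ('a \<Rightarrow> 'a) \<Rightarrow> bool" where
  "invariant_measure M f \<longleftrightarrow> f \<in> measurable M M \<and> distr M M f = M"

definition bounded_variation01 :: "(real \<Rightarrow> real) \<Rightarrow> bool" where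
  "bounded_variation01 g \<longleftrightarrow>
     bdd_above {(\<Sum>i=1..n. \<bar>g (x i) - g (x (i - 1))\<bar>) | (n::nat) x.
       x 0 = 0 \<and> x n = 1 \<and> strict_mono_on {0..n} x}"

definition has_bounded_variation_version :: "(real \<Rightarrow> real) \<Rightarrow> bool" where
  "has_bounded_variation_version h \<longleftrightarrow>
     (\<exists>g. (AE x in unit_lborel. g x = h x) \<and> bounded_variation01 g)"

definition is_density_of :: "(real \<Rightarrow> real) \<Rightarrow> real measure \<Rightarrow> bool" where
  "is_density_of h \<mu> \<longleftrightarrow>
     h \<in> borel_measurable unit_lborel \<and> (\<forall>x\<in>{0..1}. 0 \<le> h x) \<and>
     \<mu> = density unit_lborel (\<lambda>x. ennreal (h x))"

end

theory Submission
  imports Defs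
begin

text \<open>
  Since $T_1 x = T_0 (1 - x)$, the random map is a random reflection followed by the Gauss map,
  so its transfer operator is $P f = G (R f)$ with $R f(u) = p f(u) + (1 - p) f(1 - u)$ and
  $G g(x) = \sum_k u^2 g(u)$, $u = 1/(k + 1 + x)$. Every branch is full, hence $P$ preserves
  $C^1([0,1])$, and a change of variables gives
  $\int |(P f)'| \le \int (p u^2 + (1 - p)(1 - u)^2) |f'| + 2 \int f \le q \int |f'| + 2$ for
  densities $f$, with $q = \max(p, 1 - p) < 1$. Thus the total variations of the densities $P^n 1$
  stay below $2/(1 - q)$. By Helly's selection theorem their Cesaro means have a
  subsequence converging almost everywhere to a difference of monotone functions, which is the
  invariant density.
\<close>

subsection \<open>Invariance of the skew product\<close>

text \<open>Neither map alone gives a variation contraction in one step: u^2 = 1/|T_0'(u)| equals 1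
  at u = 1, and (1-u)^2 = 1/|T_1'(u)| equals 1 at u = 0, a neutral fixed point of T_1. The two bad
  points are distinct, so the averaged weight p u^2 + (1-p)(1-u)^2 stays below 1: it is convex, with
  endpoint values 1-p and p, whence q = max(p, 1-p). The constant 2/(1-q) is the fixed point of C ->
  2 + qC, so the bound reproduces itself from one iterate to the next, starting from variation 0 for
  the density 1. Working with C^1 densities turns the variation into the L^1 norm of a derivative,
  so that infinitely many branches are handled by one change of variables. The limit density need
  not be C^1; what survives is a pair of bounded monotone functions, which is the form that Helly's
  theorem accepts. Invariance comes from the averaging: applying P to a Cesaro mean changes
  integrals against indicators only by a telescoping term of order 1/n. The skew product enters only
  through p mu(T_0^{-1} B) + (1-p) mu(T_1^{-1} B) = mu(B), because the first symbol is independent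
  of the shifted sequence.\<close>

lemma space_unit_lborel [simp]: "space unit_lborel = {0..1}"
  by (simp add: unit_lborel_def space_restrict_space)

lemma sets_unit_lborel: "sets unit_lborel = sets (restrict_space borel {0..1})"
  by (simp add: unit_lborel_def sets_restrict_space)

lemma measurable_unit_lborelI:
  "f \<in> borel_measurable borel \<Longrightarrow> f \<in> borel_measurable unit_lborel"
  by (simp add: unit_lborel_def measurable_restrict_space1)

lemma frac_measurable [measurable]: "(frac :: real \<Rightarrow> real) \<in> borel_measurable borel"
  unfolding frac_def[abs_def] by measurable

lemma gauss_map_measurable: "gauss_map \<in> measurable unit_lborel unit_lborel"
proof -
  have "gauss_map \<in> borel_measurable borel"
    unfolding gauss_map_def[abs_def] by measurable
  moreover have "gauss_map x \<in> {0..1}" for x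
    using frac_lt_1[of "1 / x"] by (auto simp: gauss_map_def frac_ge_0 intro: less_imp_le)
  ultimately show ?thesis
    by (auto simp: unit_lborel_def intro!: measurable_restrict_space1 measurable_restrict_space2)
qed

lemma reflect_measurable: "(\<lambda>x::real. 1 - x) \<in> measurable unit_lborel unit_lborel"
  unfolding unit_lborel_def
  by (rule measurable_restrict_space2) (auto simp: space_restrict_space intro: measurable_restrict_space1)

lemma renyi_map_eq: "renyi_map x = gauss_map (1 - x)"
  by (simp add: renyi_map_def gauss_map_def)

lemma renyi_map_measurable: "renyi_map \<in> measurable unit_lborel unit_lborel"
  unfolding renyi_map_eq[abs_def]
  by (rule measurable_compose[OF reflect_measurable gauss_map_measurable])

lemma shift_measurable: "shift \<in> measurable (bernoulli_measure p) (bernoulli_measure p)"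
  unfolding shift_def[abs_def] bernoulli_measure_def
  by (intro measurable_PiM_single') (auto simp: space_PiM intro: measurable_component_singleton)

lemma space_bernoulli_measure [simp]: "space (bernoulli_measure p) = UNIV"
  by (simp add: bernoulli_measure_def space_PiM)

lemma prob_space_bernoulli_measure: "prob_space (bernoulli_measure p)"
  unfolding bernoulli_measure_def
  by (intro prob_space_PiM prob_space_measure_pmf)

lemma first_symbol_measurable:
  "(\<lambda>\<omega>. \<omega> 0) \<in> measurable (bernoulli_measure p) (count_space UNIV)"
proof -
  have "(\<lambda>\<omega>. \<omega> 0) \<in> measurable (bernoulli_measure p) (measure_pmf (bernoulli_pmf (1 - p)))"
    unfolding bernoulli_measure_def by (rule measurable_component_singleton) simp
  then show ?thesis by simp
qed

lemma first_shift_in_sets: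
  assumes "A \<in> sets (bernoulli_measure p)"
  shows "{\<omega>. \<omega> 0 = b \<and> shift \<omega> \<in> A} \<in> sets (bernoulli_measure p)"
proof -
  have "{\<omega>. \<omega> 0 = b \<and> shift \<omega> \<in> A} =
      (\<lambda>\<omega>. \<omega> 0) -` {b} \<inter> space (bernoulli_measure p) \<inter> (shift -` A \<inter> space (bernoulli_measure p))"
    by auto
  then show ?thesis
    using measurable_sets[OF first_symbol_measurable] measurable_sets[OF shift_measurable assms]
    by auto
qed

text \<open>This is the independence of the first symbol and the tail, together with shift
  invariance: prepending an independent symbol to a Bernoulli sequence gives a Bernoulli sequence
  again.\<close>

lemma bernoulli_measure_first_shift:
  assumes A: "A \<in> sets (bernoulli_measure p)"
  shows "emeasure (bernoulli_measure p) {\<omega>. \<omega> 0 = b \<and> shift \<omega> \<in> A} =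
    ennreal (pmf (bernoulli_pmf (1 - p)) b) * emeasure (bernoulli_measure p) A"
proof -
  let ?B = "bernoulli_measure p" and ?N = "measure_pmf (bernoulli_pmf (1 - p))"
  interpret sequence_space ?N
    by (intro sequence_space.intro product_prob_space.intro product_sigma_finite.intro
        product_prob_space_axioms.intro prob_space_measure_pmf
        prob_space_imp_sigma_finite)
  interpret B: prob_space ?B by (rule prob_space_bernoulli_measure)
  \<comment> \<open>\<open>S\<close> is the infinite product measure of the locale
    \<open>sequence_space\<close>.\<close>
  have S: "S = ?B" by (simp add: bernoulli_measure_def)
  let ?E = "{\<omega>. \<omega> 0 = b \<and> shift \<omega> \<in> A}"
  have E: "?E \<in> sets ?B" by (rule first_shift_in_sets[OF A])
  let ?f = "\<lambda>(s, \<omega>). case_nat s \<omega> :: nat \<Rightarrow> bool"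
  have f: "?f \<in> measurable (?N \<Otimes>\<^sub>M ?B) ?B"
    unfolding S[symmetric] by measurable
  \<comment> \<open>\<open>PiM_iter\<close> is the self-similarity of the infinite product under
    \<open>case_nat\<close>; the event pulls back to a rectangle.\<close>
  have "emeasure ?B ?E = emeasure (distr (?N \<Otimes>\<^sub>M ?B) ?B ?f) ?E"
    using PiM_iter unfolding S by simp
  also have "\<dots> = emeasure (?N \<Otimes>\<^sub>M ?B) (?f -` ?E \<inter> space (?N \<Otimes>\<^sub>M ?B))"
    by (rule emeasure_distr[OF f E])
  also have "?f -` ?E \<inter> space (?N \<Otimes>\<^sub>M ?B) = {b} \<times> A"
    by (auto simp: shift_def space_pair_measure)
  also have "emeasure (?N \<Otimes>\<^sub>M ?B) ({b} \<times> A) = emeasure ?N {b} * emeasure ?B A"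
    by (rule B.emeasure_pair_measure_Times) (auto simp: A)
  finally show ?thesis by (simp add: emeasure_pmf_single)
qed

text \<open>It suffices to compare the two product measures on rectangles. The preimage of a
  rectangle splits by the first symbol into two disjoint rectangles, and independence factors out
  the measure of the symbolic side.\<close>

lemma invariant_skew_productI:
  assumes "prob_space \<mu>" and S: "sets \<mu> = sets unit_lborel" and p: "0 < p" "p < 1"
    and inv: "\<And>B. B \<in> sets \<mu> \<Longrightarrow>
      ennreal p * emeasure \<mu> (gauss_map -` B \<inter> {0..1}) +
      ennreal (1 - p) * emeasure \<mu> (renyi_map -` B \<inter> {0..1}) = emeasure \<mu> B"
  shows "invariant_measure (bernoulli_measure p \<Otimes>\<^sub>M \<mu>) skew_product"
proof -
  let ?B = "bernoulli_measure p"
  interpret B: prob_space ?B by (rule prob_space_bernoulli_measure)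
  interpret M: prob_space \<mu> by fact
  have sp: "space \<mu> = {0..1}" using sets_eq_imp_space_eq[OF S] by simp
  have G: "gauss_map \<in> measurable \<mu> \<mu>" and R: "renyi_map \<in> measurable \<mu> \<mu>"
    using gauss_map_measurable renyi_map_measurable measurable_cong_sets[OF S S] by auto
  note [measurable] = shift_measurable first_symbol_measurable
  have m: "skew_product \<in> measurable (?B \<Otimes>\<^sub>M \<mu>) (?B \<Otimes>\<^sub>M \<mu>)"
    unfolding skew_product_def case_prod_beta'
    by (intro measurable_Pair measurable_If measurable_compose[OF measurable_snd R]
        measurable_compose[OF measurable_snd G] measurable_compose[OF measurable_fst shift_measurable])
      measurable
  have "?B \<Otimes>\<^sub>M \<mu> = distr (?B \<Otimes>\<^sub>M \<mu>) (?B \<Otimes>\<^sub>M \<mu>) skew_product"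
  proof (rule pair_measure_eqI)
    fix A C assume A: "A \<in> sets ?B" and C: "C \<in> sets \<mu>"
    let ?E = "\<lambda>b. {\<omega>. \<omega> 0 = b \<and> shift \<omega> \<in> A}"
    let ?G = "gauss_map -` C \<inter> {0..1}" and ?R = "renyi_map -` C \<inter> {0..1}"
    note E = first_shift_in_sets[OF A]
    have GR: "?G \<in> sets \<mu>" "?R \<in> sets \<mu>"
      using measurable_sets[OF G C] measurable_sets[OF R C] by (auto simp: sp)
    have "emeasure (distr (?B \<Otimes>\<^sub>M \<mu>) (?B \<Otimes>\<^sub>M \<mu>) skew_product) (A \<times> C)
        = emeasure (?B \<Otimes>\<^sub>M \<mu>) (skew_product -` (A \<times> C) \<inter> space (?B \<Otimes>\<^sub>M \<mu>))"
      by (rule emeasure_distr[OF m]) (use A C in auto)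
    also have "skew_product -` (A \<times> C) \<inter> space (?B \<Otimes>\<^sub>M \<mu>) = ?E False \<times> ?G \<union> ?E True \<times> ?R"
      by (auto simp: skew_product_def space_pair_measure sp split: if_splits)
    also have "emeasure (?B \<Otimes>\<^sub>M \<mu>) (?E False \<times> ?G \<union> ?E True \<times> ?R) =
        emeasure (?B \<Otimes>\<^sub>M \<mu>) (?E False \<times> ?G) + emeasure (?B \<Otimes>\<^sub>M \<mu>) (?E True \<times> ?R)"
      by (rule plus_emeasure[symmetric, OF pair_measureI[OF E GR(1)] pair_measureI[OF E GR(2)]]) auto
    also have "\<dots> = emeasure ?B (?E False) * emeasure \<mu> ?G + emeasure ?B (?E True) * emeasure \<mu> ?R"
      by (intro arg_cong2[where f="(+)"] M.emeasure_pair_measure_Times E GR)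
    also have "\<dots> = emeasure ?B A * (ennreal p * emeasure \<mu> ?G + ennreal (1 - p) * emeasure \<mu> ?R)"
      unfolding bernoulli_measure_first_shift[OF A] using p
      by (simp add: distrib_left mult_ac)
    finally show "emeasure ?B A * emeasure \<mu> C =
        emeasure (distr (?B \<Otimes>\<^sub>M \<mu>) (?B \<Otimes>\<^sub>M \<mu>) skew_product) (A \<times> C)"
      using inv[OF C] by simp
  qed (auto intro: B.sigma_finite_measure_axioms M.sigma_finite_measure_axioms)
  then show ?thesis using m by (simp add: invariant_measure_def)
qed

subsection \<open>The transfer operator of the Gauss map\<close>

lemma nn_integral_gauss_branch:
  fixes g :: "real \<Rightarrow> ennreal"
  assumes g [measurable]: "g \<in> borel_measurable borel"
  shows "(\<integral>\<^sup>+u. g u * indicator {1 / (real k + 2)..1 / (real k + 1)} u \<partial>lborel) =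
    (\<integral>\<^sup>+x. g (1 / (real k + 1 + x)) * ennreal (1 / (real k + 1 + x)\<^sup>2) * indicator {0..1} x \<partial>lborel)"
proof -
  \<comment> \<open>The substitution rule wants an increasing map, hence the detour through \<open>v = - u\<close>.\<close>
  let ?\<psi> = "\<lambda>x. - 1 / (real k + 1 + x)"
  have "(\<integral>\<^sup>+u. g u * indicator {1 / (real k + 2)..1 / (real k + 1)} u \<partial>lborel) =
    (\<integral>\<^sup>+v. g (- v) * indicator {?\<psi> 0..?\<psi> 1} v \<partial>lborel)"
    by (subst nn_integral_real_affine[where c = "-1" and t = 0])
      (auto intro!: nn_integral_cong simp: add_ac split: split_indicator)
  also have "\<dots> = (\<integral>\<^sup>+x. g (- ?\<psi> x) * ennreal (1 / (real k + 1 + x)\<^sup>2) * indicator {0..1} x \<partial>lborel)"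
  proof (rule nn_integral_substitution_aux)
    show "(?\<psi> has_real_derivative 1 / (real k + 1 + x)\<^sup>2) (at x)" if "x \<in> {0..1}" for x
      using that by (auto intro!: derivative_eq_intros simp: power2_eq_square)
    show "continuous_on {0..1} (\<lambda>x. 1 / (real k + 1 + x)\<^sup>2)"
      by (intro continuous_intros) auto
  qed auto
  finally show ?thesis by simp
qed

text \<open>The inverse branches x -> 1/(k+1+x) carry the unit interval onto intervals that tile it
  up to a countable set, so summing the substitution rule over k recovers the whole integral. All
  later integral facts about the Gauss operator rest on this identity.\<close>

lemma nn_integral_gauss_transfer:
  fixes g :: "real \<Rightarrow> ennreal"
  assumes g: "g \<in> borel_measurable unit_lborel"
  shows "(\<integral>\<^sup>+x. (\<Sum>k. ennreal (1 / (real k + 1 + x)\<^sup>2) * g (1 / (real k + 1 + x))) \<partial>unit_lborel) =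
    (\<integral>\<^sup>+u. g u \<partial>unit_lborel)"
proof -
  define G where "G u = g u * indicator {0..1} u" for u
  have G [measurable]: "G \<in> borel_measurable borel"
    using g unfolding unit_lborel_def G_def[abs_def]
    by (subst (asm) borel_measurable_restrict_space_iff_ennreal) auto
  let ?J = "\<lambda>k. {1 / (real k + 2)..1 / (real k + 1)}"
  \<comment> \<open>Neighbouring closed intervals share an endpoint, where the sum would be 2. Away
    from these points they may be replaced by half-open intervals, which partition the unit interval
    without 0.\<close>
  have un: "(\<Sum>k. indicator (?J k) u) = (indicator {0..1} u :: ennreal)"
    if "u \<noteq> 0" "u \<notin> range (\<lambda>k. 1 / (real k + 1))" for u
  proof -
    let ?I = "\<lambda>k. {1 / (real k + 2)<..1 / (real k + 1)}"
    have "(\<Sum>k. indicator (?J k) u) = (\<Sum>k. indicator (?I k) u :: ennreal)"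
    proof (intro suminf_cong)
      fix k
      have "1 / (real k + 2) = 1 / (real (Suc k) + 1)" by simp
      then have "u \<noteq> 1 / (real k + 2)" using that(2) by (metis rangeI)
      then show "indicator (?J k) u = (indicator (?I k) u :: ennreal)"
        by (auto split: split_indicator)
    qed
    also have "\<dots> = indicator (\<Union>k. ?I k) u"
    proof (rule suminf_indicator)
      show "disjoint_family ?I"
        unfolding disjoint_family_on_def
      proof (intro ballI impI)
        have *: "?I m \<inter> ?I n = {}" if "m < n" for m n :: nat
        proof -
          have "1 / (real n + 1) \<le> 1 / (real m + 2)" using that by (intro divide_left_mono) auto
          then show ?thesis by auto
        qed
        show "?I m \<inter> ?I n = {}" if "m \<noteq> n" for m n
          using *[of m n] *[of n m] that by (cases "m < n") auto
      qed
    qed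
    also have "(\<Union>k. ?I k) = {0<..1}"
    proof (intro set_eqI iffI)
      fix x :: real assume x: "x \<in> {0<..1}"
      \<comment> \<open>This is the first continued fraction digit of x. Digits start at 1 and
        branches at 0, hence the index n - 1 below.\<close>
      define n where "n = nat \<lfloor>1 / x\<rfloor>"
      have "1 \<le> 1 / x" using x by (auto simp: field_simps)
      then have n: "1 \<le> n" "real n \<le> 1 / x" "1 / x < real n + 1"
        unfolding n_def by linarith+
      have "x \<in> ?I (n - 1)" using n x by (auto simp: field_simps of_nat_diff)
      then show "x \<in> (\<Union>k. ?I k)" by blast
    next
      fix x :: real assume "x \<in> (\<Union>k. ?I k)"
      then obtain k where k: "1 / (real k + 2) < x" "x \<le> 1 / (real k + 1)" by auto
      have "0 < 1 / (real k + 2)" "1 / (real k + 1) \<le> 1" by (auto simp: field_simps)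
      then show "x \<in> {0<..1}" using k unfolding greaterThanAtMost_iff by linarith
    qed
    finally show ?thesis using that(1) by (auto split: split_indicator)
  qed
  have "(\<integral>\<^sup>+x. (\<Sum>k. ennreal (1 / (real k + 1 + x)\<^sup>2) * g (1 / (real k + 1 + x))) \<partial>unit_lborel) =
    (\<integral>\<^sup>+x. (\<Sum>k. G (1 / (real k + 1 + x)) * ennreal (1 / (real k + 1 + x)\<^sup>2) * indicator {0..1} x) \<partial>lborel)"
    unfolding unit_lborel_def
    by (subst nn_integral_restrict_space)
      (auto intro!: nn_integral_cong suminf_cong simp: G_def mult_ac split: split_indicator)
  also have "\<dots> = (\<Sum>k. \<integral>\<^sup>+x. G (1 / (real k + 1 + x)) * ennreal (1 / (real k + 1 + x)\<^sup>2) * indicator {0..1} x \<partial>lborel)"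
    by (rule nn_integral_suminf) measurable
  also have "\<dots> = (\<Sum>k. \<integral>\<^sup>+u. G u * indicator (?J k) u \<partial>lborel)"
    by (simp add: nn_integral_gauss_branch)
  also have "\<dots> = (\<integral>\<^sup>+u. (\<Sum>k. G u * indicator (?J k) u) \<partial>lborel)"
    by (rule nn_integral_suminf[symmetric]) measurable
  also have "\<dots> = (\<integral>\<^sup>+u. G u \<partial>lborel)"
  proof (rule nn_integral_cong_AE)
    have "AE u in lborel. u \<notin> insert 0 (range (\<lambda>k. 1 / (real k + 1)))"
      by (rule AE_not_in[OF countable_imp_null_set_lborel]) auto
    then show "AE u in lborel. (\<Sum>k. G u * indicator (?J k) u) = G u"
      by (rule AE_mp) (auto intro!: AE_I2 simp: un G_def split: split_indicator)
  qed
  also have "\<dots> = (\<integral>\<^sup>+u. g u \<partial>unit_lborel)"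
    unfolding unit_lborel_def G_def by (subst nn_integral_restrict_space) auto
  finally show ?thesis .
qed

section \<open>The Gauss operator on continuously differentiable functions\<close>

text \<open>The derivative is an explicit argument because its L^1 norm serves as the total
  variation; at 0 and 1 it is one-sided.\<close>

definition C1_01 :: "(real \<Rightarrow> real) \<Rightarrow> (real \<Rightarrow> real) \<Rightarrow> bool" where
  "C1_01 f f' \<longleftrightarrow> continuous_on {0..1} f' \<and>
     (\<forall>x\<in>{0..1}. (f has_real_derivative f' x) (at x within {0..1}))"

lemma C1_01_continuous: "C1_01 f f' \<Longrightarrow> continuous_on {0..1} f"
  unfolding C1_01_def by (meson DERIV_continuous_on)

lemma continuous_on_unit_measurable:
  "continuous_on {0..1} f \<Longrightarrow> (f :: real \<Rightarrow> real) \<in> borel_measurable unit_lborel"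
  using borel_measurable_continuous_on_restrict[of "{0..1}" f]
  by (simp add: measurable_cong_sets[OF sets_unit_lborel refl])

lemma continuous_on_unit_bounded:
  assumes "continuous_on {0..1} (f :: real \<Rightarrow> real)"
  obtains K where "\<And>x. x \<in> {0..1} \<Longrightarrow> \<bar>f x\<bar> \<le> K"
proof -
  have "bounded (f ` {0..1})"
    by (intro compact_imp_bounded compact_continuous_image assms) auto
  then obtain K where "\<forall>x\<in>{0..1}. \<bar>f x\<bar> \<le> K"
    unfolding bounded_iff by auto
  then show ?thesis using that[of K] by auto
qed

lemma gauss_branch_bounds:
  fixes x :: real
  assumes "x \<in> {0..1}"
  shows "1 / (real k + 1 + x) \<in> {0..1}" "1 / (real k + 1 + x)\<^sup>2 \<le> 1 / (real k + 1)\<^sup>2"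
proof -
  show "1 / (real k + 1 + x) \<in> {0..1}" using assms by (auto simp: field_simps)
  have "(real k + 1)\<^sup>2 \<le> (real k + 1 + x)\<^sup>2" using assms by (intro power_mono) auto
  then show "1 / (real k + 1 + x)\<^sup>2 \<le> 1 / (real k + 1)\<^sup>2"
    using assms by (intro divide_left_mono mult_pos_pos zero_less_power) auto
qed

lemma summable_inverse_square_shift: "summable (\<lambda>k. K * (1 / (real k + 1)\<^sup>2))"
proof -
  have "summable (\<lambda>n. inverse (real (Suc n) ^ 2))"
    by (subst summable_Suc_iff) (rule inverse_power_summable, simp)
  then show ?thesis by (intro summable_mult) (simp add: inverse_eq_divide add.commute)
qed

text \<open>The Perron-Frobenius operator of the Gauss map, as a real series so that it can be
  differentiated term by term.\<close>

definition gauss_transfer :: "(real \<Rightarrow> real) \<Rightarrow> real \<Rightarrow> real" where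
  "gauss_transfer g x = (\<Sum>k. 1 / (real k + 1 + x)\<^sup>2 * g (1 / (real k + 1 + x)))"

text \<open>
  For \<open>u = 1 / (k + 1 + x)\<close> we have \<open>du/dx = - u\<^sup>2\<close>, so the derivative of \<open>u\<^sup>2 g u\<close> with respect
  to \<open>x\<close> is \<open>u\<^sup>2\<close> times the following function of \<open>u\<close>: the derivative of a transferred function is
  again a transferred function.
\<close>

definition gauss_weight_deriv :: "(real \<Rightarrow> real) \<Rightarrow> (real \<Rightarrow> real) \<Rightarrow> real \<Rightarrow> real" where
  "gauss_weight_deriv g g' u = - (2 * u * g u + u\<^sup>2 * g' u)"

text \<open>Dropping x from the weight gives a summable majorant uniform in x, as the Weierstrass
  test requires.\<close>

lemma gauss_transfer_bound:
  assumes "\<And>u. u \<in> {0..1} \<Longrightarrow> \<bar>g u\<bar> \<le> K" "x \<in> {0..1}"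
  shows "\<bar>1 / (real k + 1 + x)\<^sup>2 * g (1 / (real k + 1 + x))\<bar> \<le> K * (1 / (real k + 1)\<^sup>2)"
proof -
  have "\<bar>1 / (real k + 1 + x)\<^sup>2 * g (1 / (real k + 1 + x))\<bar> = 1 / (real k + 1 + x)\<^sup>2 * \<bar>g (1 / (real k + 1 + x))\<bar>"
    by (simp add: abs_mult)
  also have "\<dots> \<le> 1 / (real k + 1)\<^sup>2 * K"
    by (intro mult_mono assms gauss_branch_bounds) auto
  finally show ?thesis by (simp add: mult.commute)
qed

lemma gauss_transfer_summable:
  assumes "\<And>u. u \<in> {0..1} \<Longrightarrow> \<bar>g u\<bar> \<le> K" "x \<in> {0..1}"
  shows "summable (\<lambda>k. \<bar>1 / (real k + 1 + x)\<^sup>2 * g (1 / (real k + 1 + x))\<bar>)"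
  by (rule summable_comparison_test'[OF summable_inverse_square_shift, of 0 _ K])
    (use gauss_transfer_bound[OF assms] in auto)

lemma C1_01_gauss_weight_deriv:
  assumes "C1_01 g g'"
  shows "continuous_on {0..1} (gauss_weight_deriv g g')"
  unfolding gauss_weight_deriv_def using assms C1_01_continuous[OF assms]
  by (auto intro!: continuous_intros simp: C1_01_def)

text \<open>Termwise differentiation: each term is differentiable on the whole interval, and the
  differentiated series converges uniformly because it is the transfer series of a bounded
  function.\<close>

lemma C1_01_gauss_transfer:
  assumes g: "C1_01 g g'"
  shows "C1_01 (gauss_transfer g) (gauss_transfer (gauss_weight_deriv g g'))"
proof -
  let ?w = "gauss_weight_deriv g g'"
  let ?\<psi> = "\<lambda>k x. 1 / (real k + 1 + x)"
  let ?f = "\<lambda>k x. 1 / (real k + 1 + x)\<^sup>2 * g (?\<psi> k x)"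
  let ?f' = "\<lambda>k x. 1 / (real k + 1 + x)\<^sup>2 * ?w (?\<psi> k x)"
  have wc: "continuous_on {0..1} ?w" by (rule C1_01_gauss_weight_deriv[OF g])
  obtain K where K: "\<And>u. u \<in> {0..1} \<Longrightarrow> \<bar>g u\<bar> \<le> K"
    using continuous_on_unit_bounded[OF C1_01_continuous[OF g]] by metis
  obtain L where L: "\<And>u. u \<in> {0..1} \<Longrightarrow> \<bar>?w u\<bar> \<le> L"
    using continuous_on_unit_bounded[OF wc] by metis
  have sm: "summable (\<lambda>k. ?f k x)" if "x \<in> {0..1}" for x
    using summable_rabs_cancel[OF gauss_transfer_summable[OF K that]] by simp
  have d: "(?f k has_real_derivative ?f' k x) (at x within {0..1})" if x: "x \<in> {0..1}" for k x
  proof -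
    have p: "real k + 1 + x > 0" using x by auto
    have 1: "(?\<psi> k has_real_derivative - 1 / (real k + 1 + x)\<^sup>2) (at x within {0..1})"
      using p by (auto intro!: derivative_eq_intros simp: power2_eq_square)
    have 2: "(g has_real_derivative g' (?\<psi> k x)) (at (?\<psi> k x) within ?\<psi> k ` {0..1})"
      by (rule DERIV_subset[of _ _ _ "{0..1}"])
        (use g gauss_branch_bounds(1) x in \<open>auto simp: C1_01_def simp del: atLeastAtMost_iff\<close>)
    have 3: "((\<lambda>x. 1 / (real k + 1 + x)\<^sup>2) has_real_derivative - 2 / (real k + 1 + x) ^ 3) (at x within {0..1})"
      using p by (auto intro!: derivative_eq_intros simp: divide_simps power2_eq_square power3_eq_cube)
    have "(?f k has_real_derivative
        - 2 / (real k + 1 + x) ^ 3 * g (?\<psi> k x) +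
        g' (?\<psi> k x) * (- 1 / (real k + 1 + x)\<^sup>2) * (1 / (real k + 1 + x)\<^sup>2)) (at x within {0..1})"
      using DERIV_mult[OF 3 DERIV_image_chain[OF 2 1]] by (simp add: o_def)
    also have "- 2 / (real k + 1 + x) ^ 3 * g (?\<psi> k x) +
        g' (?\<psi> k x) * (- 1 / (real k + 1 + x)\<^sup>2) * (1 / (real k + 1 + x)\<^sup>2) = ?f' k x"
    proof -
      have "- 2 / w ^ 3 * a + b * (- 1 / w\<^sup>2) * (1 / w\<^sup>2) =
          1 / w\<^sup>2 * - (2 * (1 / w) * a + (1 / w)\<^sup>2 * b)" if "w \<noteq> 0" for a b w :: real
        using that by (simp add: field_simps power2_eq_square power3_eq_cube)
      then show ?thesis using p unfolding gauss_weight_deriv_def by auto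
    qed
    finally show ?thesis .
  qed
  have b: "norm (?f' k x) \<le> L * (1 / (real k + 1)\<^sup>2)" if "x \<in> {0..1}" for k x
    unfolding real_norm_def by (rule gauss_transfer_bound[OF L that])
  have u: "uniform_limit {0..1} (\<lambda>n x. \<Sum>k<n. ?f' k x) (gauss_transfer ?w) sequentially"
    unfolding gauss_transfer_def
    by (rule Weierstrass_m_test[OF b summable_inverse_square_shift])
  have "continuous_on {0..1} (gauss_transfer ?w)"
  proof (rule uniform_limit_theorem[OF _ u])
    have "continuous_on {0..1} (\<lambda>x. ?w (?\<psi> k x))" for k
      by (rule continuous_on_compose2[OF wc])
        (use gauss_branch_bounds(1) in \<open>auto intro!: continuous_intros simp del: atLeastAtMost_iff\<close>, auto)
    then show "\<forall>\<^sub>F n in sequentially. continuous_on {0..1} (\<lambda>x. \<Sum>k<n. ?f' k x)"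
      by (intro always_eventually allI continuous_intros) auto
  qed auto
  moreover
  \<comment> \<open>The series theorem yields only some limit function \<open>h\<close>, from
    summability at the base point 0; uniqueness of sums then identifies it with
    \<open>gauss_transfer g\<close> on the interval.\<close>
  obtain h where h: "\<And>x. x \<in> {0..1} \<Longrightarrow> (\<lambda>k. ?f k x) sums h x"
      "\<And>x. x \<in> {0..1} \<Longrightarrow> (h has_real_derivative gauss_transfer ?w x) (at x within {0..1})"
    using has_field_derivative_series[OF convex_real_interval(5) d u, of 0] sm[of 0] by force
  have "(gauss_transfer g has_real_derivative gauss_transfer ?w x) (at x within {0..1})"
    if "x \<in> {0..1}" for x
    by (rule has_field_derivative_transform_within[OF h(2)[OF that] zero_less_one that])
      (use h(1) in \<open>auto simp: gauss_transfer_def sums_iff\<close>)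
  ultimately show ?thesis by (auto simp: C1_01_def)
qed

text \<open>The L^1 contraction property: the triangle inequality inside the series, then the change
  of variables applied to |g|.\<close>

lemma nn_integral_abs_gauss_transfer_le:
  assumes g: "continuous_on {0..1} g"
  shows "(\<integral>\<^sup>+x. ennreal \<bar>gauss_transfer g x\<bar> \<partial>unit_lborel) \<le> (\<integral>\<^sup>+x. ennreal \<bar>g x\<bar> \<partial>unit_lborel)"
proof -
  obtain K where K: "\<And>u. u \<in> {0..1} \<Longrightarrow> \<bar>g u\<bar> \<le> K"
    using continuous_on_unit_bounded[OF g] by metis
  have "(\<integral>\<^sup>+x. ennreal \<bar>gauss_transfer g x\<bar> \<partial>unit_lborel) \<le>
    (\<integral>\<^sup>+x. (\<Sum>k. ennreal (1 / (real k + 1 + x)\<^sup>2) * ennreal \<bar>g (1 / (real k + 1 + x))\<bar>) \<partial>unit_lborel)"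
  proof (rule nn_integral_mono)
    fix x assume "x \<in> space unit_lborel"
    then have x: "x \<in> {0..1}" by simp
    note s = gauss_transfer_summable[OF K x]
    have "ennreal \<bar>gauss_transfer g x\<bar> \<le> ennreal (\<Sum>k. \<bar>1 / (real k + 1 + x)\<^sup>2 * g (1 / (real k + 1 + x))\<bar>)"
      unfolding gauss_transfer_def by (intro ennreal_leI summable_rabs s)
    also have "\<dots> = (\<Sum>k. ennreal \<bar>1 / (real k + 1 + x)\<^sup>2 * g (1 / (real k + 1 + x))\<bar>)"
      by (rule suminf_ennreal2[symmetric]) (use s in auto)
    also have "\<dots> = (\<Sum>k. ennreal (1 / (real k + 1 + x)\<^sup>2) * ennreal \<bar>g (1 / (real k + 1 + x))\<bar>)"
      by (intro suminf_cong, subst ennreal_mult[symmetric]) (auto simp: abs_mult)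
    finally show "ennreal \<bar>gauss_transfer g x\<bar> \<le>
        (\<Sum>k. ennreal (1 / (real k + 1 + x)\<^sup>2) * ennreal \<bar>g (1 / (real k + 1 + x))\<bar>)" .
  qed
  also have "\<dots> = (\<integral>\<^sup>+x. ennreal \<bar>g x\<bar> \<partial>unit_lborel)"
    by (rule nn_integral_gauss_transfer) (use continuous_on_unit_measurable[OF g] in measurable)
  finally show ?thesis .
qed

lemma gauss_transfer_nonneg:
  assumes g: "continuous_on {0..1} g" and nn: "\<And>u. u \<in> {0..1} \<Longrightarrow> 0 \<le> g u" and x: "x \<in> {0..1}"
  shows "0 \<le> gauss_transfer g x"
proof -
  obtain K where K: "\<And>u. u \<in> {0..1} \<Longrightarrow> \<bar>g u\<bar> \<le> K"
    using continuous_on_unit_bounded[OF g] by metis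
  show ?thesis
    unfolding gauss_transfer_def
    using summable_rabs_cancel[OF gauss_transfer_summable[OF K x]] nn gauss_branch_bounds(1)[OF x]
    by (intro suminf_nonneg mult_nonneg_nonneg) auto
qed

text \<open>Each inverse branch is undone by the Gauss map, so the test function can be pulled into
  every term as its composite with the map before the variables are changed.\<close>

lemma nn_integral_gauss_transfer_dual:
  assumes g: "continuous_on {0..1} g" and nn: "\<And>u. u \<in> {0..1} \<Longrightarrow> 0 \<le> g u"
    and \<phi>: "\<phi> \<in> borel_measurable unit_lborel"
  shows "(\<integral>\<^sup>+x. \<phi> x * ennreal (gauss_transfer g x) \<partial>unit_lborel) =
    (\<integral>\<^sup>+u. \<phi> (gauss_map u) * ennreal (g u) \<partial>unit_lborel)"
proof -
  obtain K where K: "\<And>u. u \<in> {0..1} \<Longrightarrow> \<bar>g u\<bar> \<le> K"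
    using continuous_on_unit_bounded[OF g] by metis
  have [measurable]: "(\<lambda>u. \<phi> (gauss_map u)) \<in> borel_measurable unit_lborel"
    by (rule measurable_compose[OF gauss_map_measurable \<phi>])
  have [measurable]: "g \<in> borel_measurable unit_lborel"
    by (rule continuous_on_unit_measurable[OF g])
  have "(\<integral>\<^sup>+x. \<phi> x * ennreal (gauss_transfer g x) \<partial>unit_lborel) =
    (\<integral>\<^sup>+x. (\<Sum>k. ennreal (1 / (real k + 1 + x)\<^sup>2) *
      (\<phi> (gauss_map (1 / (real k + 1 + x))) * ennreal (g (1 / (real k + 1 + x))))) \<partial>unit_lborel)"
  proof (rule nn_integral_cong_AE)
    \<comment> \<open>At x = 1 the branch point 1/(k+2) is sent to 0 instead of 1, so the termwise
      identity fails there.\<close>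
    have "AE x in lborel. x \<noteq> (1::real)" by (rule AE_lborel_singleton)
    then have "AE x in unit_lborel. x \<noteq> 1"
      unfolding unit_lborel_def by (subst AE_restrict_space_iff) auto
    then show "AE x in unit_lborel. \<phi> x * ennreal (gauss_transfer g x) =
      (\<Sum>k. ennreal (1 / (real k + 1 + x)\<^sup>2) *
      (\<phi> (gauss_map (1 / (real k + 1 + x))) * ennreal (g (1 / (real k + 1 + x)))))"
    proof (rule AE_mp, intro AE_I2 impI)
      fix x assume "x \<in> space unit_lborel" "x \<noteq> 1"
      then have x: "x \<in> {0..1}" "x \<in> {0..<1}" by auto
      have *: "gauss_map (1 / (real k + 1 + x)) = x" for k
      proof -
        have "frac (real k + 1 + x) = x"
          using x(2) frac_unique_iff[of "real k + 1 + x" x] by auto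
        then show ?thesis using x by (simp add: gauss_map_def)
      qed
      have "ennreal (gauss_transfer g x) =
          (\<Sum>k. ennreal (1 / (real k + 1 + x)\<^sup>2 * g (1 / (real k + 1 + x))))"
        unfolding gauss_transfer_def
        using summable_rabs_cancel[OF gauss_transfer_summable[OF K x(1)]] nn gauss_branch_bounds(1)[OF x(1)]
        by (intro suminf_ennreal2[symmetric] mult_nonneg_nonneg) auto
      also have "\<dots> = (\<Sum>k. ennreal (1 / (real k + 1 + x)\<^sup>2) * ennreal (g (1 / (real k + 1 + x))))"
        using nn gauss_branch_bounds(1)[OF x(1)] by (intro suminf_cong ennreal_mult) auto
      finally show "\<phi> x * ennreal (gauss_transfer g x) =
        (\<Sum>k. ennreal (1 / (real k + 1 + x)\<^sup>2) *
        (\<phi> (gauss_map (1 / (real k + 1 + x))) * ennreal (g (1 / (real k + 1 + x)))))"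
        unfolding * by (simp add: mult.left_commute)
    qed
  qed
  also have "\<dots> = (\<integral>\<^sup>+u. \<phi> (gauss_map u) * ennreal (g u) \<partial>unit_lborel)"
    by (rule nn_integral_gauss_transfer) measurable
  finally show ?thesis .
qed

lemma nn_integral_reflect:
  assumes "f \<in> borel_measurable unit_lborel"
  shows "(\<integral>\<^sup>+x. f (1 - x) \<partial>unit_lborel) = (\<integral>\<^sup>+x. f x \<partial>unit_lborel)"
proof -
  define F where "F u = f u * indicator {0..1} u" for u
  have [measurable]: "F \<in> borel_measurable borel"
    using assms unfolding unit_lborel_def F_def[abs_def]
    by (subst (asm) borel_measurable_restrict_space_iff_ennreal) auto
  have "(\<integral>\<^sup>+x. f x \<partial>unit_lborel) = (\<integral>\<^sup>+x. F x \<partial>lborel)"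
    unfolding unit_lborel_def F_def by (subst nn_integral_restrict_space) auto
  also have "\<dots> = (\<integral>\<^sup>+x. F (1 - x) \<partial>lborel)"
    by (subst nn_integral_real_affine[where c = "-1" and t = 1]) auto
  also have "\<dots> = (\<integral>\<^sup>+x. f (1 - x) \<partial>unit_lborel)"
    unfolding unit_lborel_def F_def
    by (subst nn_integral_restrict_space) (auto intro!: nn_integral_cong split: split_indicator)
  finally show ?thesis by simp
qed

subsection \<open>The random transfer operator\<close>

text \<open>For a density \<open>f\<close>, this is the density of a random point after it has been
  reflected with probability 1 - p.\<close>

definition random_reflect :: "real \<Rightarrow> (real \<Rightarrow> real) \<Rightarrow> real \<Rightarrow> real" where
  "random_reflect p f u = p * f u + (1 - p) * f (1 - u)"

definition random_transfer :: "real \<Rightarrow> (real \<Rightarrow> real) \<Rightarrow> real \<Rightarrow> real" where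
  "random_transfer p f = gauss_transfer (random_reflect p f)"

lemma C1_01_random_reflect:
  assumes f: "C1_01 f f'"
  shows "C1_01 (random_reflect p f) (\<lambda>u. p * f' u - (1 - p) * f' (1 - u))"
proof -
  have c: "continuous_on {0..1} f'" and d: "\<And>x. x \<in> {0..1} \<Longrightarrow> (f has_real_derivative f' x) (at x within {0..1})"
    using f by (auto simp: C1_01_def)
  have "continuous_on {0..1} (\<lambda>u. f' (1 - u))"
    by (rule continuous_on_compose2[OF c]) (auto intro!: continuous_intros)
  moreover have "(random_reflect p f has_real_derivative p * f' x - (1 - p) * f' (1 - x)) (at x within {0..1})"
    if x: "x \<in> {0..1}" for x
  proof -
    have "(f has_real_derivative f' (1 - x)) (at (1 - x) within (\<lambda>u. 1 - u) ` {0..1})"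
      by (rule DERIV_subset[OF d]) (use x in auto)
    moreover have "((\<lambda>u. 1 - u) has_real_derivative - 1) (at x within {0..1})"
      by (auto intro!: derivative_eq_intros)
    ultimately have "((\<lambda>u. f (1 - u)) has_real_derivative f' (1 - x) * - 1) (at x within {0..1})"
      using DERIV_image_chain by (force simp: o_def)
    then have "((\<lambda>u. p * f u + (1 - p) * f (1 - u)) has_real_derivative
        p * f' x + (1 - p) * (f' (1 - x) * - 1)) (at x within {0..1})"
      by (intro DERIV_add DERIV_cmult d x)
    then show ?thesis by (simp add: random_reflect_def[abs_def])
  qed
  ultimately show ?thesis using c by (auto simp: C1_01_def intro!: continuous_intros)
qed

text \<open>The substitution u -> 1 - u moves the reflection from \<open>f\<close> to the weight, so
  only the averaged weight matters. It serves for the constant weight 2 and for u^2; the latter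
  provides the contraction.\<close>

lemma nn_integral_random_reflect_le:
  assumes p: "0 < p" "p < 1" and w: "\<And>u. u \<in> {0..1} \<Longrightarrow> 0 \<le> w u"
    and m: "f \<in> borel_measurable unit_lborel" "w \<in> borel_measurable unit_lborel"
    and q: "\<And>u. u \<in> {0..1} \<Longrightarrow> p * w u + (1 - p) * w (1 - u) \<le> q"
  shows "(\<integral>\<^sup>+u. ennreal (w u * (p * \<bar>f u\<bar> + (1 - p) * \<bar>f (1 - u)\<bar>)) \<partial>unit_lborel) \<le>
    ennreal q * (\<integral>\<^sup>+u. ennreal \<bar>f u\<bar> \<partial>unit_lborel)"
proof -
  note [measurable] = m measurable_compose[OF reflect_measurable m(1)] measurable_compose[OF reflect_measurable m(2)]
  have "(\<integral>\<^sup>+u. ennreal (w u * (p * \<bar>f u\<bar> + (1 - p) * \<bar>f (1 - u)\<bar>)) \<partial>unit_lborel) =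
    (\<integral>\<^sup>+u. ennreal (p * w u * \<bar>f u\<bar>) + ennreal ((1 - p) * w u * \<bar>f (1 - u)\<bar>) \<partial>unit_lborel)"
    using p w by (intro nn_integral_cong)
      (auto simp: ennreal_plus[symmetric] algebra_simps mult_le_one mult_left_le_one_le simp del: ennreal_plus)
  also have "\<dots> = (\<integral>\<^sup>+u. ennreal (p * w u * \<bar>f u\<bar>) \<partial>unit_lborel) + (\<integral>\<^sup>+u. ennreal ((1 - p) * w u * \<bar>f (1 - u)\<bar>) \<partial>unit_lborel)"
    by (rule nn_integral_add) measurable
  also have "(\<integral>\<^sup>+u. ennreal ((1 - p) * w u * \<bar>f (1 - u)\<bar>) \<partial>unit_lborel) =
     (\<integral>\<^sup>+u. ennreal ((1 - p) * w (1 - u) * \<bar>f u\<bar>) \<partial>unit_lborel)"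
    by (subst nn_integral_reflect[symmetric]) simp_all
  also have "(\<integral>\<^sup>+u. ennreal (p * w u * \<bar>f u\<bar>) \<partial>unit_lborel) + \<dots> =
     (\<integral>\<^sup>+u. ennreal (p * w u * \<bar>f u\<bar>) + ennreal ((1 - p) * w (1 - u) * \<bar>f u\<bar>) \<partial>unit_lborel)"
    by (rule nn_integral_add[symmetric]) measurable
  also have "\<dots> \<le> (\<integral>\<^sup>+u. ennreal q * ennreal \<bar>f u\<bar> \<partial>unit_lborel)"
  proof (rule nn_integral_mono)
    fix u assume "u \<in> space unit_lborel"
    then have u: "u \<in> {0..1}" "1 - u \<in> {0..1}" by auto
    have nn: "0 \<le> p * w u" "0 \<le> (1 - p) * w (1 - u)" using p w u by auto
    have "ennreal (p * w u * \<bar>f u\<bar>) + ennreal ((1 - p) * w (1 - u) * \<bar>f u\<bar>) =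
        ennreal ((p * w u + (1 - p) * w (1 - u)) * \<bar>f u\<bar>)"
      using nn by (subst ennreal_plus[symmetric]) (auto simp: distrib_right)
    also have "\<dots> \<le> ennreal (q * \<bar>f u\<bar>)"
      by (intro ennreal_leI mult_right_mono q u) auto
    also have "\<dots> = ennreal q * ennreal \<bar>f u\<bar>"
      using nn q[OF u(1)] by (intro ennreal_mult) auto
    finally show "ennreal (p * w u * \<bar>f u\<bar>) + ennreal ((1 - p) * w (1 - u) * \<bar>f u\<bar>) \<le> ennreal q * ennreal \<bar>f u\<bar>" .
  qed
  also have "\<dots> = ennreal q * (\<integral>\<^sup>+u. ennreal \<bar>f u\<bar> \<partial>unit_lborel)"
    by (rule nn_integral_cmult) measurable
  finally show ?thesis .
qed

text \<open>Duality for the Gauss operator handles the first map; reflecting the second half of the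
  integral turns the Gauss map into the Renyi map. The test function 1 gives conservation of mass,
  indicators give invariance.\<close>

lemma nn_integral_random_transfer_dual:
  assumes p: "0 < p" "p < 1"
    and f: "continuous_on {0..1} f" and nn: "\<And>u. u \<in> {0..1} \<Longrightarrow> 0 \<le> f u"
    and \<phi>: "\<phi> \<in> borel_measurable unit_lborel"
  shows "(\<integral>\<^sup>+x. \<phi> x * ennreal (random_transfer p f x) \<partial>unit_lborel) =
    (\<integral>\<^sup>+u. (ennreal p * \<phi> (gauss_map u) + ennreal (1 - p) * \<phi> (renyi_map u)) * ennreal (f u) \<partial>unit_lborel)"
proof -
  have fr: "continuous_on {0..1} (\<lambda>u. f (1 - u))"
    by (rule continuous_on_compose2[OF f]) (auto intro!: continuous_intros)
  have c: "continuous_on {0..1} (random_reflect p f)"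
    unfolding random_reflect_def[abs_def] by (intro continuous_intros f fr)
  have [measurable]: "f \<in> borel_measurable unit_lborel" "(\<lambda>u. f (1 - u)) \<in> borel_measurable unit_lborel"
    "(\<lambda>u. \<phi> (gauss_map u)) \<in> borel_measurable unit_lborel"
    "(\<lambda>u. \<phi> (renyi_map u)) \<in> borel_measurable unit_lborel"
    by (intro continuous_on_unit_measurable f fr measurable_compose[OF gauss_map_measurable \<phi>]
        measurable_compose[OF renyi_map_measurable \<phi>])+
  have "(\<integral>\<^sup>+x. \<phi> x * ennreal (random_transfer p f x) \<partial>unit_lborel) =
    (\<integral>\<^sup>+u. \<phi> (gauss_map u) * ennreal (random_reflect p f u) \<partial>unit_lborel)"
    unfolding random_transfer_def
    by (rule nn_integral_gauss_transfer_dual[OF c _ \<phi>])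
      (use p nn in \<open>auto simp: random_reflect_def\<close>)
  also have "\<dots> = (\<integral>\<^sup>+u. ennreal p * \<phi> (gauss_map u) * ennreal (f u) +
      ennreal (1 - p) * \<phi> (gauss_map u) * ennreal (f (1 - u)) \<partial>unit_lborel)"
  proof (rule nn_integral_cong)
    fix u assume "u \<in> space unit_lborel"
    then have u: "0 \<le> f u" "0 \<le> f (1 - u)" using nn by auto
    have "ennreal (random_reflect p f u) = ennreal p * ennreal (f u) + ennreal (1 - p) * ennreal (f (1 - u))"
      using p u unfolding random_reflect_def by (simp add: ennreal_mult)
    then show "\<phi> (gauss_map u) * ennreal (random_reflect p f u) =
        ennreal p * \<phi> (gauss_map u) * ennreal (f u) +
      ennreal (1 - p) * \<phi> (gauss_map u) * ennreal (f (1 - u))"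
      by (simp add: distrib_left mult_ac)
  qed
  also have "\<dots> = (\<integral>\<^sup>+u. ennreal p * \<phi> (gauss_map u) * ennreal (f u) \<partial>unit_lborel) +
      (\<integral>\<^sup>+u. ennreal (1 - p) * \<phi> (gauss_map u) * ennreal (f (1 - u)) \<partial>unit_lborel)"
    by (rule nn_integral_add) measurable
  also have "(\<integral>\<^sup>+u. ennreal (1 - p) * \<phi> (gauss_map u) * ennreal (f (1 - u)) \<partial>unit_lborel) =
      (\<integral>\<^sup>+u. ennreal (1 - p) * \<phi> (renyi_map u) * ennreal (f u) \<partial>unit_lborel)"
    unfolding renyi_map_eq by (subst nn_integral_reflect[symmetric]) simp_all
  also have "(\<integral>\<^sup>+u. ennreal p * \<phi> (gauss_map u) * ennreal (f u) \<partial>unit_lborel) + \<dots> =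
      (\<integral>\<^sup>+u. ennreal p * \<phi> (gauss_map u) * ennreal (f u) +
        ennreal (1 - p) * \<phi> (renyi_map u) * ennreal (f u) \<partial>unit_lborel)"
    by (rule nn_integral_add[symmetric]) measurable
  finally show ?thesis by (simp add: distrib_right)
qed

section \<open>Uniform variation bound for the iterates\<close>

definition bv_density :: "real \<Rightarrow> (real \<Rightarrow> real) \<Rightarrow> bool" where
  "bv_density C f \<longleftrightarrow> (\<forall>x\<in>{0..1}. 0 \<le> f x) \<and> (\<integral>\<^sup>+x. ennreal (f x) \<partial>unit_lborel) = 1 \<and>
     (\<exists>f'. C1_01 f f' \<and> (\<integral>\<^sup>+x. ennreal \<bar>f' x\<bar> \<partial>unit_lborel) \<le> ennreal C)"

text \<open>A Lasota-Yorke inequality: the new variation is at most 2 + q C, and C is chosen so that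
  this equals C.\<close>

lemma bv_density_random_transfer:
  assumes p: "0 < p" "p < 1" and f: "bv_density C f" and C: "C = 2 / (1 - max p (1 - p))"
  shows "bv_density C (random_transfer p f)"
proof -
  let ?q = "max p (1 - p)" and ?g = "random_reflect p f"
  obtain f' where nn: "\<And>x. x \<in> {0..1} \<Longrightarrow> 0 \<le> f x" and one: "(\<integral>\<^sup>+x. ennreal (f x) \<partial>unit_lborel) = 1"
    and f': "C1_01 f f'" and V: "(\<integral>\<^sup>+x. ennreal \<bar>f' x\<bar> \<partial>unit_lborel) \<le> ennreal C"
    using f unfolding bv_density_def by blast
  define g' where "g' = (\<lambda>u. p * f' u - (1 - p) * f' (1 - u))"
  have g': "C1_01 ?g g'" unfolding g'_def by (rule C1_01_random_reflect[OF f'])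
  have fc: "continuous_on {0..1} f" and fc': "continuous_on {0..1} f'" and gc: "continuous_on {0..1} ?g"
    and gc': "continuous_on {0..1} g'"
    using f' g' C1_01_continuous by (auto simp: C1_01_def)
  have fr: "continuous_on {0..1} (\<lambda>u. f (1 - u))" "continuous_on {0..1} (\<lambda>u. f' (1 - u))"
    by (rule continuous_on_compose2[OF fc] continuous_on_compose2[OF fc'], auto intro!: continuous_intros)+
  note [measurable] = fr[THEN continuous_on_unit_measurable] fc[THEN continuous_on_unit_measurable]
    fc'[THEN continuous_on_unit_measurable]
  have id [measurable]: "(\<lambda>u. u\<^sup>2) \<in> borel_measurable unit_lborel"
    by (rule measurable_unit_lborelI) measurable
  have q: "0 \<le> ?q" "?q < 1" "0 \<le> C" using p by (auto simp: C)
  have gn: "0 \<le> ?g u" if "u \<in> {0..1}" for u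
    using that p nn by (auto simp: random_reflect_def)
  have "0 \<le> random_transfer p f x" if "x \<in> {0..1}" for x
    unfolding random_transfer_def by (rule gauss_transfer_nonneg[OF gc gn that])
  moreover have "(\<integral>\<^sup>+x. ennreal (random_transfer p f x) \<partial>unit_lborel) = 1"
  proof -
    have "ennreal p + ennreal (1 - p) = 1"
      using p by (subst ennreal_plus[symmetric]) auto
    then show ?thesis
      using nn_integral_random_transfer_dual[OF p fc nn, of "\<lambda>_. 1"] one by simp
  qed
  moreover have "C1_01 (random_transfer p f) (gauss_transfer (gauss_weight_deriv ?g g'))"
    unfolding random_transfer_def by (rule C1_01_gauss_transfer[OF g'])
  moreover have "(\<integral>\<^sup>+x. ennreal \<bar>gauss_transfer (gauss_weight_deriv ?g g') x\<bar> \<partial>unit_lborel) \<le> ennreal C"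
  proof -
    have "(\<integral>\<^sup>+x. ennreal \<bar>gauss_transfer (gauss_weight_deriv ?g g') x\<bar> \<partial>unit_lborel) \<le>
      (\<integral>\<^sup>+u. ennreal \<bar>gauss_weight_deriv ?g g' u\<bar> \<partial>unit_lborel)"
      by (rule nn_integral_abs_gauss_transfer_le[OF C1_01_gauss_weight_deriv[OF g']])
    \<comment> \<open>In the term with \<open>f\<close> the factor u may be bounded by 1, since the
      mass of \<open>f\<close> is fixed. In the term with the derivative u^2 has to stay, as it
      carries the contraction.\<close>
    also have "\<dots> \<le> (\<integral>\<^sup>+u. ennreal (2 * (p * \<bar>f u\<bar> + (1 - p) * \<bar>f (1 - u)\<bar>)) +
        ennreal (u\<^sup>2 * (p * \<bar>f' u\<bar> + (1 - p) * \<bar>f' (1 - u)\<bar>)) \<partial>unit_lborel)"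
    proof (rule nn_integral_mono)
      fix u assume "u \<in> space unit_lborel"
      then have u: "u \<in> {0..1}" "1 - u \<in> {0..1}" by auto
      have "\<bar>gauss_weight_deriv ?g g' u\<bar> \<le> 2 * u * ?g u + u\<^sup>2 * \<bar>g' u\<bar>"
        unfolding gauss_weight_deriv_def using u gn[OF u(1)]
        by (simp add: abs_le_iff) (smt (verit) mult_nonneg_nonneg zero_le_power2 abs_mult mult_minus_right abs_ge_self abs_ge_minus_self mult_left_mono)
      also have "2 * u * ?g u \<le> 2 * 1 * ?g u"
        using u gn[OF u(1)] by (intro mult_right_mono) auto
      also have "?g u = p * \<bar>f u\<bar> + (1 - p) * \<bar>f (1 - u)\<bar>"
        using nn u by (auto simp: random_reflect_def)
      also have "u\<^sup>2 * \<bar>g' u\<bar> \<le> u\<^sup>2 * (p * \<bar>f' u\<bar> + (1 - p) * \<bar>f' (1 - u)\<bar>)"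
        unfolding g'_def using p
        by (intro mult_left_mono order_trans[OF abs_triangle_ineq4]) (auto simp: abs_mult)
      finally have "\<bar>gauss_weight_deriv ?g g' u\<bar> \<le> 2 * (p * \<bar>f u\<bar> + (1 - p) * \<bar>f (1 - u)\<bar>) +
         u\<^sup>2 * (p * \<bar>f' u\<bar> + (1 - p) * \<bar>f' (1 - u)\<bar>)" by simp
      then have "ennreal \<bar>gauss_weight_deriv ?g g' u\<bar> \<le>
          ennreal (2 * (p * \<bar>f u\<bar> + (1 - p) * \<bar>f (1 - u)\<bar>) +
            u\<^sup>2 * (p * \<bar>f' u\<bar> + (1 - p) * \<bar>f' (1 - u)\<bar>))"
        by (rule ennreal_leI)
      also have "\<dots> = ennreal (2 * (p * \<bar>f u\<bar> + (1 - p) * \<bar>f (1 - u)\<bar>)) +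
          ennreal (u\<^sup>2 * (p * \<bar>f' u\<bar> + (1 - p) * \<bar>f' (1 - u)\<bar>))"
        using p by (intro ennreal_plus) auto
      finally show "ennreal \<bar>gauss_weight_deriv ?g g' u\<bar> \<le>
          ennreal (2 * (p * \<bar>f u\<bar> + (1 - p) * \<bar>f (1 - u)\<bar>)) +
          ennreal (u\<^sup>2 * (p * \<bar>f' u\<bar> + (1 - p) * \<bar>f' (1 - u)\<bar>))" .
    qed
    also have "\<dots> = (\<integral>\<^sup>+u. ennreal (2 * (p * \<bar>f u\<bar> + (1 - p) * \<bar>f (1 - u)\<bar>)) \<partial>unit_lborel) +
        (\<integral>\<^sup>+u. ennreal (u\<^sup>2 * (p * \<bar>f' u\<bar> + (1 - p) * \<bar>f' (1 - u)\<bar>)) \<partial>unit_lborel)"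
      by (rule nn_integral_add) measurable
    also have "\<dots> \<le> ennreal 2 * (\<integral>\<^sup>+u. ennreal \<bar>f u\<bar> \<partial>unit_lborel) + ennreal ?q * (\<integral>\<^sup>+u. ennreal \<bar>f' u\<bar> \<partial>unit_lborel)"
    proof (intro add_mono nn_integral_random_reflect_le p)
      fix u :: real assume u: "u \<in> {0..1}"
      \<comment> \<open>Squares on the unit interval are at most their base, so the average is at
        most a convex combination of p and 1 - p.\<close>
      have "p * u\<^sup>2 + (1 - p) * (1 - u)\<^sup>2 \<le> ?q * u + ?q * (1 - u)"
        using u p by (intro add_mono mult_mono) (auto simp: power2_eq_square mult_left_le)
      then show "p * u\<^sup>2 + (1 - p) * (1 - u)\<^sup>2 \<le> ?q" by (simp add: algebra_simps)
    qed auto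
    also have "(\<integral>\<^sup>+u. ennreal \<bar>f u\<bar> \<partial>unit_lborel) = 1"
      unfolding one[symmetric] using nn by (intro nn_integral_cong) auto
    also have "ennreal 2 * 1 + ennreal ?q * (\<integral>\<^sup>+u. ennreal \<bar>f' u\<bar> \<partial>unit_lborel) \<le>
        ennreal 2 * 1 + ennreal ?q * ennreal C"
      by (intro add_mono mult_left_mono V) auto
    also have "\<dots> = ennreal (2 + ?q * C)"
      using q by (simp add: ennreal_mult ennreal_plus)
    also have "2 + ?q * C = C"
    proof -
      have "2 + t * (2 / (1 - t)) = 2 / (1 - t)" if "t < 1" for t :: real
        using that by (simp add: field_simps)
      then show ?thesis using q(2) unfolding C by blast
    qed
    finally show ?thesis .
  qed
  ultimately show ?thesis unfolding bv_density_def by blast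
qed

subsection \<open>Compactness\<close>

lemma emeasure_unit_lborel_space: "emeasure unit_lborel {0..1} = 1"
  unfolding unit_lborel_def by (subst emeasure_restrict_space) auto

lemma prob_space_unit_lborel: "prob_space unit_lborel"
  by (rule prob_spaceI) (simp add: emeasure_unit_lborel_space)

text \<open>The Jordan decomposition: \<open>A\<close> is the running variation and \<open>B\<close>
  is \<open>A\<close> minus the density. Both are extended continuously to the real line, with
  bounds depending on C alone, to fit Helly's theorem.\<close>

lemma bv_density_mono_decomposition:
  assumes f: "bv_density C f" and C: "0 \<le> C"
  obtains A B where "mono A" "mono B" "continuous_on UNIV A" "continuous_on UNIV B"
    "\<And>x. \<bar>A x\<bar> \<le> 1 + C" "\<And>x. \<bar>B x\<bar> \<le> 1 + C" "\<And>x. x \<in> {0..1} \<Longrightarrow> f x = A x - B x"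
proof -
  obtain f' where nn: "\<And>x. x \<in> {0..1} \<Longrightarrow> 0 \<le> f x" and one: "(\<integral>\<^sup>+x. ennreal (f x) \<partial>unit_lborel) = 1"
    and f': "C1_01 f f'" and V: "(\<integral>\<^sup>+x. ennreal \<bar>f' x\<bar> \<partial>unit_lborel) \<le> ennreal C"
    using f unfolding bv_density_def by blast
  have fc: "continuous_on {0..1} f" by (rule C1_01_continuous[OF f'])
  have c': "continuous_on {0..1} (\<lambda>x. \<bar>f' x\<bar>)" "continuous_on {0..1} f'"
    using f' by (auto simp: C1_01_def intro!: continuous_intros)
  define a where "a x = integral {0..x} (\<lambda>x. \<bar>f' x\<bar>)" for x :: real
  have int: "(\<lambda>x. \<bar>f' x\<bar>) integrable_on {x..y}" if "0 \<le> x" "y \<le> 1" for x y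
    by (rule integrable_continuous_real, rule continuous_on_subset[OF c'(1)]) (use that in auto)
  have a_diff: "a y - a x = integral {x..y} (\<lambda>x. \<bar>f' x\<bar>)" if "0 \<le> x" "x \<le> y" "y \<le> 1" for x y
    using Henstock_Kurzweil_Integration.integral_combine[OF that(1,2) int[OF order_refl that(3)]]
    by (simp add: a_def)
  have f_diff: "\<bar>f y - f x\<bar> \<le> a y - a x" if xy: "0 \<le> x" "x \<le> y" "y \<le> 1" for x y
  proof -
    have "(f' has_integral (f y - f x)) {x..y}"
    proof (rule fundamental_theorem_of_calculus[OF xy(2)])
      fix z assume z: "z \<in> {x..y}"
      have "(f has_real_derivative f' z) (at z within {0..1})"
        using f' z xy by (auto simp: C1_01_def)
      then have "(f has_real_derivative f' z) (at z within {x..y})"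
        by (rule DERIV_subset) (use xy in auto)
      then show "(f has_vector_derivative f' z) (at z within {x..y})"
        by (simp add: has_real_derivative_iff_has_vector_derivative)
    qed
    then have "f y - f x = integral {x..y} f'" "f' integrable_on {x..y}"
      by (auto simp: integral_unique)
    then show ?thesis
      unfolding a_diff[OF xy]
      using integral_norm_bound_integral[of f' "{x..y}" "\<lambda>x. \<bar>f' x\<bar>"] int[OF xy(1,3)] by auto
  qed
  have a_mono: "a x \<le> a y" if "0 \<le> x" "x \<le> y" "y \<le> 1" for x y
    using f_diff[OF that] by linarith
  have a0: "a 0 = 0" by (simp add: a_def)
  have a1: "a 1 \<le> C"
  proof -
    have "ennreal (a 1) = (\<integral>\<^sup>+x. ennreal (indicator {0..1} x * \<bar>f' x\<bar>) \<partial>lborel)"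
      unfolding a_def
      by (rule nn_integral_has_integral_lebesgue[symmetric])
        (use int[of 0 1] in \<open>auto intro: integrable_integral\<close>)
    also have "\<dots> = (\<integral>\<^sup>+x. ennreal \<bar>f' x\<bar> \<partial>unit_lborel)"
      unfolding unit_lborel_def by (subst nn_integral_restrict_space) (auto intro!: nn_integral_cong split: split_indicator)
    finally have "ennreal (a 1) \<le> ennreal C" using V by simp
    then show ?thesis using C by (simp add: ennreal_le_iff)
  qed
  \<comment> \<open>A larger value would, with oscillation at most C, force the density above a
    constant exceeding 1 everywhere, contradicting mass 1.\<close>
  have f_le: "f x \<le> 1 + C" if x: "x \<in> {0..1}" for x
  proof (rule ccontr)
    assume "\<not> f x \<le> 1 + C"
    then have e: "1 < f x - C" by simp
    have "f x - C \<le> f y" if y: "y \<in> {0..1}" for y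
    proof -
      have "\<bar>f y - f x\<bar> \<le> a 1 - a 0"
        using f_diff[of x y] f_diff[of y x] a_mono[of 0 x] a_mono[of 0 y] a_mono[of x 1] a_mono[of y 1] x y
        by (cases "x \<le> y") auto
      then show ?thesis using a0 a1 by linarith
    qed
    then have "(\<integral>\<^sup>+y. ennreal (f x - C) \<partial>unit_lborel) \<le> (\<integral>\<^sup>+y. ennreal (f y) \<partial>unit_lborel)"
      by (intro nn_integral_mono ennreal_leI) simp
    then have "ennreal (f x - C) \<le> 1"
      by (simp add: one emeasure_unit_lborel_space)
    then show False using e by simp
  qed
  \<comment> \<open>Clamping to the unit interval gives the extension by constants, preserving
    monotonicity and continuity.\<close>
  define c :: "real \<Rightarrow> real" where "c x = max 0 (min 1 x)" for x
  have c01: "0 \<le> c x" "c x \<le> 1" "x \<le> y \<Longrightarrow> c x \<le> c y" for x y by (auto simp: c_def)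
  have cc: "continuous_on UNIV c" unfolding c_def[abs_def] by (intro continuous_intros)
  have ac: "continuous_on {0..1} a"
    unfolding a_def[abs_def] by (rule indefinite_integral_continuous_1[OF int]) auto
  show ?thesis
  proof
    show "mono (\<lambda>x. a (c x))" by (intro monoI a_mono c01)
    show "mono (\<lambda>x. a (c x) - f (c x))"
    proof (intro monoI)
      fix x y :: real assume "x \<le> y"
      then show "a (c x) - f (c x) \<le> a (c y) - f (c y)"
        using f_diff[of "c x" "c y"] c01 by fastforce
    qed
    show "continuous_on UNIV (\<lambda>x. a (c x))"
      by (rule continuous_on_compose2[OF ac cc]) (auto simp: c01)
    moreover have "continuous_on UNIV (\<lambda>x. f (c x))"
      by (rule continuous_on_compose2[OF fc cc]) (auto simp: c01)
    ultimately show "continuous_on UNIV (\<lambda>x. a (c x) - f (c x))"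
      by (intro continuous_intros)
    fix x
    have "0 \<le> a (c x)" "a (c x) \<le> C"
      using a_mono[of 0 "c x"] a_mono[of "c x" 1] a0 a1 c01[of x] by auto
    moreover have "0 \<le> f (c x)" "f (c x) \<le> 1 + C"
      using nn f_le c01[of x] by auto
    ultimately show "\<bar>a (c x)\<bar> \<le> 1 + C" "\<bar>a (c x) - f (c x)\<bar> \<le> 1 + C" by auto
    show "f x = a (c x) - (a (c x) - f (c x))" if "x \<in> {0..1}"
      using that by (auto simp: c_def)
  qed
qed

text \<open>Truncation at 0 is 1-Lipschitz, so every increment is at most that of F + H, and those
  telescope.\<close>

lemma bounded_variation01_mono_diff:
  assumes F: "mono F" and H: "mono H"
  shows "bounded_variation01 (\<lambda>x. max 0 (F x - H x))"
  unfolding bounded_variation01_def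
proof (rule bdd_aboveI, clarify)
  fix n :: nat and x :: "nat \<Rightarrow> real"
  assume x: "x 0 = 0" "x n = 1" "strict_mono_on {0..n} x"
  have "(\<Sum>i=1..n. \<bar>max 0 (F (x i) - H (x i)) - max 0 (F (x (i - 1)) - H (x (i - 1)))\<bar>) \<le>
    (\<Sum>i=1..n. (F (x i) + H (x i)) - (F (x (i - 1)) + H (x (i - 1))))"
  proof (rule sum_mono)
    fix i assume i: "i \<in> {1..n}"
    have "x (i - 1) \<le> x i"
      using strict_mono_onD[OF x(3), of "i - 1" i] i by auto
    then have "F (x (i - 1)) \<le> F (x i)" "H (x (i - 1)) \<le> H (x i)"
      using F H by (auto dest: monoD)
    then show "\<bar>max 0 (F (x i) - H (x i)) - max 0 (F (x (i - 1)) - H (x (i - 1)))\<bar> \<le>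
        (F (x i) + H (x i)) - (F (x (i - 1)) + H (x (i - 1)))" by linarith
  qed
  also have "\<dots> = (F 1 + H 1) - (F 0 + H 0)"
    using sum_telescope''[of 0 n "\<lambda>i. F (x i) + H (x i)"] x by simp
  finally show "(\<Sum>i=1..n. \<bar>max 0 (F (x i) - H (x i)) - max 0 (F (x (i - 1)) - H (x (i - 1)))\<bar>) \<le> (F 1 + H 1) - (F 0 + H 0)" .
qed

text \<open>Helly's theorem is applied to the first family, then to the second along the subsequence
  found. Convergence can fail only at discontinuities of the monotone limits, a countable
  set.\<close>

lemma mono_diff_compactness:
  fixes a b :: "nat \<Rightarrow> real \<Rightarrow> real"
  assumes "\<And>n. mono (a n)" "\<And>n. mono (b n)"
    and "\<And>n. continuous_on UNIV (a n)" "\<And>n. continuous_on UNIV (b n)"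
    and "\<And>n x. \<bar>a n x\<bar> \<le> M" "\<And>n x. \<bar>b n x\<bar> \<le> M"
  obtains s F H where "strict_mono (s :: nat \<Rightarrow> nat)" "mono F" "mono H"
    "AE x in lborel. (\<lambda>n. a (s n) x - b (s n) x) \<longlonglongrightarrow> F x - H x"
proof -
  have cr: "continuous (at_right x) (a n)" "continuous (at_right x) (b n)" for n x
    using assms(3,4)[of n]
    by (simp_all add: continuous_on_eq_continuous_at continuous_at_imp_continuous_at_within)
  obtain s F where s: "strict_mono s" "mono F" "\<And>x. isCont F x \<Longrightarrow> (\<lambda>n. a (s n) x) \<longlonglongrightarrow> F x"
    using Helly_selection[of a, OF cr(1) assms(1) assms(5)] by blast
  obtain t H where t: "strict_mono t" "mono H" "\<And>x. isCont H x \<Longrightarrow> (\<lambda>n. b (s (t n)) x) \<longlonglongrightarrow> H x"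
    using Helly_selection[of "\<lambda>n. b (s n)", OF cr(2) assms(2) assms(6)] by blast
  have "AE x in lborel. x \<notin> {x. \<not> isCont F x} \<union> {x. \<not> isCont H x}"
    by (intro AE_not_in countable_imp_null_set_lborel countable_Un mono_ctble_discont s t)
  then have "AE x in lborel. (\<lambda>n. a (s (t n)) x - b (s (t n)) x) \<longlonglongrightarrow> F x - H x"
  proof eventually_elim
    case (elim x)
    then have "(\<lambda>n. a (s (t n)) x) \<longlonglongrightarrow> F x"
      using LIMSEQ_subseq_LIMSEQ[OF s(3) t(1), of x] by (simp add: o_def)
    then show ?case using t(3)[of x] elim by (intro tendsto_diff) auto
  qed
  then show ?thesis
    using that[OF strict_mono_o[OF s(1) t(1)] s(2) t(2)] by simp
qed

lemma cesaro_shift_diff_tendsto_zero: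
  fixes c :: "nat \<Rightarrow> real"
  assumes "\<And>i. 0 \<le> c i" "\<And>i. c i \<le> 1"
  shows "(\<lambda>n. (\<Sum>i\<le>n. c (Suc i)) / real (Suc n) - (\<Sum>i\<le>n. c i) / real (Suc n)) \<longlonglongrightarrow> 0"
proof (rule Lim_null_comparison)
  have "(\<Sum>i\<le>n. c (Suc i)) / real (Suc n) - (\<Sum>i\<le>n. c i) / real (Suc n) = (c (Suc n) - c 0) / real (Suc n)" for n
  proof -
    have "(\<Sum>i\<le>n. c (Suc i)) - (\<Sum>i\<le>n. c i) = c (Suc n) - c 0" by (induction n) auto
    then show ?thesis by (simp add: diff_divide_distrib[symmetric])
  qed
  moreover have "\<bar>c (Suc n) - c 0\<bar> \<le> 1" for n
    using assms[of 0] assms[of "Suc n"] by auto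
  ultimately show "\<forall>\<^sub>F n in sequentially.
      norm ((\<Sum>i\<le>n. c (Suc i)) / real (Suc n) - (\<Sum>i\<le>n. c i) / real (Suc n)) \<le> 1 / real (Suc n)"
    by (auto intro!: always_eventually divide_right_mono)
  show "(\<lambda>n. 1 / real (Suc n)) \<longlonglongrightarrow> 0"
    using LIMSEQ_inverse_real_of_nat by (simp add: inverse_eq_divide)
qed

section \<open>Existence of the invariant density\<close>

lemma bv_density_one: "0 \<le> C \<Longrightarrow> bv_density C (\<lambda>_. 1)"
  unfolding bv_density_def C1_01_def
  by (auto simp: emeasure_unit_lborel_space intro!: exI[of _ "\<lambda>_. 0"] derivative_eq_intros)

text \<open>The duality is restated with real integrals because the Cesaro argument subtracts
  them.\<close>

lemma integral_unit_lborel_indicator_random_transfer: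
  assumes p: "0 < p" "p < 1" and f: "bv_density C f" and E: "E \<in> sets unit_lborel"
  shows "(\<integral>x. indicator E x * random_transfer p f x \<partial>unit_lborel) =
    (\<integral>u. (p * indicator E (gauss_map u) + (1 - p) * indicator E (renyi_map u)) * f u \<partial>unit_lborel)"
proof -
  obtain f' where nn: "\<And>x. x \<in> {0..1} \<Longrightarrow> 0 \<le> f x" and f': "C1_01 f f'"
    using f unfolding bv_density_def by blast
  have fc: "continuous_on {0..1} f" by (rule C1_01_continuous[OF f'])
  have Pc: "continuous_on {0..1} (random_transfer p f)"
    unfolding random_transfer_def
    by (rule C1_01_continuous[OF C1_01_gauss_transfer[OF C1_01_random_reflect[OF f']]])
  have rc: "continuous_on {0..1} (random_reflect p f)"
    by (rule C1_01_continuous[OF C1_01_random_reflect[OF f']])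
  have Pnn: "0 \<le> random_transfer p f x" if "x \<in> {0..1}" for x
    unfolding random_transfer_def
    by (rule gauss_transfer_nonneg[OF rc _ that]) (use p nn in \<open>auto simp: random_reflect_def\<close>)
  have iE [measurable]: "(indicator E :: real \<Rightarrow> real) \<in> borel_measurable unit_lborel"
    "(indicator E :: real \<Rightarrow> ennreal) \<in> borel_measurable unit_lborel"
    using E by auto
  note [measurable] = continuous_on_unit_measurable[OF fc] continuous_on_unit_measurable[OF Pc]
    measurable_compose[OF gauss_map_measurable iE(1)] measurable_compose[OF renyi_map_measurable iE(1)]
  have "(\<integral>x. indicator E x * random_transfer p f x \<partial>unit_lborel) =
      enn2real (\<integral>\<^sup>+x. ennreal (indicator E x * random_transfer p f x) \<partial>unit_lborel)"
    by (rule integral_eq_nn_integral) (use Pnn in auto)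
  also have "(\<integral>\<^sup>+x. ennreal (indicator E x * random_transfer p f x) \<partial>unit_lborel) =
      (\<integral>\<^sup>+x. indicator E x * ennreal (random_transfer p f x) \<partial>unit_lborel)"
    by (intro nn_integral_cong) (auto split: split_indicator)
  also have "\<dots> = (\<integral>\<^sup>+u. (ennreal p * indicator E (gauss_map u) + ennreal (1 - p) * indicator E (renyi_map u)) * ennreal (f u) \<partial>unit_lborel)"
    by (rule nn_integral_random_transfer_dual[OF p fc nn iE(2)])
  also have "\<dots> = (\<integral>\<^sup>+u. ennreal ((p * indicator E (gauss_map u) + (1 - p) * indicator E (renyi_map u)) * f u) \<partial>unit_lborel)"
  proof (rule nn_integral_cong)
    fix u assume "u \<in> space unit_lborel"
    then have "0 \<le> f u" using nn by auto
    moreover have "ennreal p * indicator E (gauss_map u) + ennreal (1 - p) * indicator E (renyi_map u) =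
        ennreal (p * indicator E (gauss_map u) + (1 - p) * indicator E (renyi_map u))"
      using p ennreal_plus[of p "1 - p"] by (auto split: split_indicator simp del: ennreal_plus)
    ultimately show "(ennreal p * indicator E (gauss_map u) + ennreal (1 - p) * indicator E (renyi_map u)) * ennreal (f u) =
      ennreal ((p * indicator E (gauss_map u) + (1 - p) * indicator E (renyi_map u)) * f u)"
      using p by (simp add: ennreal_mult')
  qed
  also have "enn2real \<dots> = (\<integral>u. (p * indicator E (gauss_map u) + (1 - p) * indicator E (renyi_map u)) * f u \<partial>unit_lborel)"
    by (rule integral_eq_nn_integral[symmetric]) (use p nn in auto)
  finally show ?thesis .
qed

text \<open>A Krylov-Bogoliubov argument at the level of densities: almost everywhere convergence
  with a uniform bound lets integrals against bounded test functions pass to the limit.\<close>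

lemma ex_invariant_bv_density:
  assumes p: "0 < p" "p < 1"
  obtains h where "h \<in> borel_measurable borel" "\<And>x. 0 \<le> h x" "bounded_variation01 h"
    "integrable unit_lborel h" "(\<integral>x. h x \<partial>unit_lborel) = 1"
    "\<And>E. E \<in> sets unit_lborel \<Longrightarrow>
      (\<integral>u. (p * indicator E (gauss_map u) + (1 - p) * indicator E (renyi_map u)) * h u \<partial>unit_lborel) =
      (\<integral>u. indicator E u * h u \<partial>unit_lborel)"
proof -
  interpret U: prob_space unit_lborel by (rule prob_space_unit_lborel)
  define C where "C = 2 / (1 - max p (1 - p))"
  have C: "0 \<le> C" using p by (auto simp: C_def)
  define f where "f i = (random_transfer p ^^ i) (\<lambda>_. 1)" for i
  have f: "bv_density C (f i)" for i
    by (induction i) (auto simp: f_def bv_density_one[OF C] intro: bv_density_random_transfer[OF p _ C_def])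
  have fnn: "0 \<le> f i x" if "x \<in> {0..1}" for i x
    using f[of i] that by (auto simp: bv_density_def)
  have fint1: "(\<integral>\<^sup>+x. ennreal (f i x) \<partial>unit_lborel) = 1" for i
    using f[of i] by (auto simp: bv_density_def)
  have fm [measurable]: "f i \<in> borel_measurable unit_lborel" for i
    using f[of i] unfolding bv_density_def by (blast intro: continuous_on_unit_measurable C1_01_continuous)
  have fi: "integrable unit_lborel (f i)" for i
    by (rule integrableI_nonneg) (use fnn in \<open>auto simp: fint1\<close>)
  have "\<exists>A B. mono A \<and> mono B \<and> continuous_on UNIV A \<and> continuous_on UNIV B \<and>
      (\<forall>x. \<bar>A x\<bar> \<le> 1 + C) \<and> (\<forall>x. \<bar>B x\<bar> \<le> 1 + C) \<and> (\<forall>x\<in>{0..1}. f i x = A x - B x)" for i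
    using bv_density_mono_decomposition[OF f C] by metis
  then obtain A B where AB: "\<And>i. mono (A i)" "\<And>i. mono (B i)" "\<And>i. continuous_on UNIV (A i)"
      "\<And>i. continuous_on UNIV (B i)" "\<And>i x. \<bar>A i x\<bar> \<le> 1 + C" "\<And>i x. \<bar>B i x\<bar> \<le> 1 + C"
      "\<And>i x. x \<in> {0..1} \<Longrightarrow> f i x = A i x - B i x"
    by metis
  \<comment> \<open>The two monotone parts are averaged separately, since averages keep
    monotonicity, continuity and the bound 1 + C.\<close>
  define avg :: "(nat \<Rightarrow> real \<Rightarrow> real) \<Rightarrow> nat \<Rightarrow> real \<Rightarrow> real"
    where "avg g n x = (\<Sum>i\<le>n. g i x) / real (Suc n)" for g n x
  have avg_mono: "mono (avg g n)" if "\<And>i. mono (g i)" for g n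
    unfolding avg_def by (intro monoI divide_right_mono sum_mono monoD[OF that]) auto
  have avg_cont: "continuous_on UNIV (avg g n)" if "\<And>i. continuous_on UNIV (g i)" for g n
    unfolding avg_def[abs_def] by (intro continuous_intros that) auto
  have avg_bound: "\<bar>avg g n x\<bar> \<le> 1 + C" if "\<And>i x. \<bar>g i x\<bar> \<le> 1 + C" for g n x
  proof -
    have "\<bar>\<Sum>i\<le>n. g i x\<bar> \<le> (\<Sum>i\<le>n. 1 + C)"
      by (rule order_trans[OF sum_abs sum_mono[OF that]])
    then show ?thesis unfolding avg_def by (simp add: pos_divide_le_eq mult.commute)
  qed
  obtain s F H where s: "strict_mono s" and F: "mono F" and H: "mono H"
    and lim: "AE x in lborel. (\<lambda>n. avg A (s n) x - avg B (s n) x) \<longlonglongrightarrow> F x - H x"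
    by (rule mono_diff_compactness[of "avg A" "avg B" "1 + C",
          OF avg_mono[OF AB(1)] avg_mono[OF AB(2)] avg_cont[OF AB(3)] avg_cont[OF AB(4)]
            avg_bound[OF AB(5)] avg_bound[OF AB(6)]])
  have avg_eq: "avg A n x - avg B n x = avg f n x" if "x \<in> {0..1}" for n x
    using AB(7)[OF that] unfolding avg_def by (simp add: sum_subtractf diff_divide_distrib)
  have avg_nn: "0 \<le> avg f n x" if "x \<in> {0..1}" for n x
    unfolding avg_def by (intro divide_nonneg_nonneg sum_nonneg fnn that) auto
  \<comment> \<open>The difference is known to be nonnegative only where the averages converge;
    truncation makes it so everywhere and changes it only on a null set within the unit
    interval.\<close>
  define h where "h x = max 0 (F x - H x)" for x
  have hm: "h \<in> borel_measurable borel"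
    unfolding h_def[abs_def] using borel_measurable_mono[OF F] borel_measurable_mono[OF H] by measurable
  note [measurable] = measurable_unit_lborelI[OF hm]
  have "AE x in unit_lborel. (\<lambda>n. avg A (s n) x - avg B (s n) x) \<longlonglongrightarrow> F x - H x"
    using lim unfolding unit_lborel_def by (subst AE_restrict_space_iff) (auto elim: AE_mp)
  then have lim': "AE x in unit_lborel. (\<lambda>n. avg f (s n) x) \<longlonglongrightarrow> h x"
  proof (rule AE_mp, intro AE_I2 impI)
    fix x assume "x \<in> space unit_lborel" and L: "(\<lambda>n. avg A (s n) x - avg B (s n) x) \<longlonglongrightarrow> F x - H x"
    then have x: "x \<in> {0..1}" by simp
    have L': "(\<lambda>n. avg f (s n) x) \<longlonglongrightarrow> F x - H x"
      using L unfolding avg_eq[OF x] .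
    have "0 \<le> F x - H x"
      by (rule LIMSEQ_le_const[OF L']) (use avg_nn[OF x] in auto)
    then show "(\<lambda>n. avg f (s n) x) \<longlonglongrightarrow> h x" using L' by (simp add: h_def)
  qed
  have favg_m [measurable]: "avg f n \<in> borel_measurable unit_lborel" for n
    unfolding avg_def[abs_def] by measurable
  have conv: "integrable unit_lborel (\<lambda>x. \<psi> x * h x)"
    "(\<lambda>n. \<integral>x. \<psi> x * avg f (s n) x \<partial>unit_lborel) \<longlonglongrightarrow> (\<integral>x. \<psi> x * h x \<partial>unit_lborel)"
    if m [measurable]: "\<psi> \<in> borel_measurable unit_lborel" and b: "\<And>x. \<bar>\<psi> x\<bar> \<le> 1" for \<psi>
  proof -
    have l: "AE x in unit_lborel. (\<lambda>n. \<psi> x * avg f (s n) x) \<longlonglongrightarrow> \<psi> x * h x"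
      using lim' by eventually_elim (intro tendsto_intros)
    \<comment> \<open>The dominating constant is the sum of the bounds for the two monotone
      parts.\<close>
    have d: "AE x in unit_lborel. norm (\<psi> x * avg f (s n) x) \<le> 2 * (1 + C)" for n
    proof (rule AE_I2)
      fix x assume "x \<in> space unit_lborel"
      then have "\<bar>avg f (s n) x\<bar> \<le> 2 * (1 + C)"
        using avg_eq[of x "s n"] avg_bound[of A "s n" x, OF AB(5)] avg_bound[of B "s n" x, OF AB(6)] by auto
      then show "norm (\<psi> x * avg f (s n) x) \<le> 2 * (1 + C)"
        using mult_mono[OF b[of x], of "\<bar>avg f (s n) x\<bar>" "2 * (1 + C)"] by (simp add: abs_mult)
    qed
    show "integrable unit_lborel (\<lambda>x. \<psi> x * h x)"
      by (rule integrable_dominated_convergence[OF _ _ _ l d]) auto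
    show "(\<lambda>n. \<integral>x. \<psi> x * avg f (s n) x \<partial>unit_lborel) \<longlonglongrightarrow> (\<integral>x. \<psi> x * h x \<partial>unit_lborel)"
      by (rule integral_dominated_convergence[OF _ _ _ l d]) auto
  qed
  have int_avg: "(\<integral>x. \<psi> x * avg f n x \<partial>unit_lborel) = (\<Sum>i\<le>n. \<integral>x. \<psi> x * f i x \<partial>unit_lborel) / real (Suc n)"
    if m [measurable]: "\<psi> \<in> borel_measurable unit_lborel" and b: "\<And>x. \<bar>\<psi> x\<bar> \<le> 1" for \<psi> n
  proof -
    have i: "integrable unit_lborel (\<lambda>x. \<psi> x * f i x)" for i
      by (rule Bochner_Integration.integrable_bound[OF fi[of i]])
        (use b in \<open>auto simp: abs_mult intro!: AE_I2 mult_left_le_one_le\<close>)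
    have "(\<integral>x. \<psi> x * avg f n x \<partial>unit_lborel) = (\<integral>x. (\<Sum>i\<le>n. \<psi> x * f i x) / real (Suc n) \<partial>unit_lborel)"
      by (simp add: avg_def sum_distrib_left)
    then show ?thesis by (simp add: Bochner_Integration.integral_sum[OF i])
  qed
  have inv: "(\<integral>u. (p * indicator E (gauss_map u) + (1 - p) * indicator E (renyi_map u)) * h u \<partial>unit_lborel) =
      (\<integral>u. indicator E u * h u \<partial>unit_lborel)" if E: "E \<in> sets unit_lborel" for E
  proof -
    let ?\<psi> = "\<lambda>u. p * indicator E (gauss_map u) + (1 - p) * indicator E (renyi_map u) :: real"
    let ?\<phi> = "indicator E :: real \<Rightarrow> real"
    have \<phi>m [measurable]: "?\<phi> \<in> borel_measurable unit_lborel" using E by auto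
    note [measurable] = measurable_compose[OF gauss_map_measurable \<phi>m]
      measurable_compose[OF renyi_map_measurable \<phi>m]
    have \<psi>m: "?\<psi> \<in> borel_measurable unit_lborel" by measurable
    have \<psi>b: "\<bar>?\<psi> u\<bar> \<le> 1" for u using p by (auto split: split_indicator)
    have \<phi>b: "\<bar>?\<phi> u\<bar> \<le> 1" for u by (auto split: split_indicator)
    define c where "c i = (\<integral>x. ?\<phi> x * f i x \<partial>unit_lborel)" for i
    \<comment> \<open>Duality trades the averaged preimage test function for one more application of
      the operator, so invariance becomes a shift of the sequence \<open>c\<close>.\<close>
    have d: "(\<integral>x. ?\<psi> x * f i x \<partial>unit_lborel) = c (Suc i)" for i
      unfolding c_def using integral_unit_lborel_indicator_random_transfer[OF p f E, of i]
      by (simp add: f_def)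
    have c0: "0 \<le> c i" for i
      unfolding c_def by (rule integral_nonneg_AE, rule AE_I2) (use fnn in auto)
    have c1: "c i \<le> 1" for i
    proof -
      have "c i \<le> (\<integral>x. f i x \<partial>unit_lborel)"
        unfolding c_def
        by (rule integral_mono_AE'[OF fi]) (use fnn in \<open>auto intro!: AE_I2 split: split_indicator\<close>)
      also have "\<dots> = 1"
        by (subst integral_eq_nn_integral) (use fnn in \<open>auto simp: fint1\<close>)
      finally show ?thesis .
    qed
    \<comment> \<open>The same sequence of differences has limit 0 by telescoping and, by dominated
      convergence, the difference of the integrals against \<open>h\<close>.\<close>
    have "(\<lambda>n. (\<integral>x. ?\<psi> x * avg f (s n) x \<partial>unit_lborel) - (\<integral>x. ?\<phi> x * avg f (s n) x \<partial>unit_lborel)) \<longlonglongrightarrow> 0"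
      using LIMSEQ_subseq_LIMSEQ[OF cesaro_shift_diff_tendsto_zero[of c, OF c0 c1] s]
      unfolding int_avg[OF \<psi>m \<psi>b] int_avg[OF \<phi>m \<phi>b] d c_def[symmetric] by (simp add: o_def)
    moreover have "(\<lambda>n. (\<integral>x. ?\<psi> x * avg f (s n) x \<partial>unit_lborel) - (\<integral>x. ?\<phi> x * avg f (s n) x \<partial>unit_lborel))
        \<longlonglongrightarrow> (\<integral>x. ?\<psi> x * h x \<partial>unit_lborel) - (\<integral>x. ?\<phi> x * h x \<partial>unit_lborel)"
      by (intro tendsto_diff conv(2) \<psi>m \<psi>b \<phi>m \<phi>b)
    ultimately show ?thesis using LIMSEQ_unique by fastforce
  qed
  have hi: "integrable unit_lborel h" using conv(1)[of "\<lambda>_. 1"] by simp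
  have h1: "(\<integral>x. h x \<partial>unit_lborel) = 1"
  proof -
    have "(\<integral>x. f i x \<partial>unit_lborel) = 1" for i
      by (subst integral_eq_nn_integral) (use fnn in \<open>auto simp: fint1\<close>)
    then have "(\<integral>x. 1 * avg f (s n) x \<partial>unit_lborel) = 1" for n
      by (subst int_avg) auto
    then show ?thesis using conv(2)[of "\<lambda>_. 1"] LIMSEQ_unique[OF tendsto_const] by fastforce
  qed
  show ?thesis
    by (rule that[OF hm _ _ hi h1 inv])
      (auto simp: h_def[abs_def] bounded_variation01_mono_diff[OF F H])
qed

theorem theorem3p2:
  fixes p :: real
  assumes "0 < p" and "p < 1"
  shows "\<exists>\<mu> :: real measure.
    prob_space \<mu> \<and> sets \<mu> = sets unit_lborel \<and>
    absolutely_continuous unit_lborel \<mu> \<and>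
    invariant_measure (bernoulli_measure p \<Otimes>\<^sub>M \<mu>) skew_product \<and>
    (\<exists>h. is_density_of h \<mu> \<and> has_bounded_variation_version h)"
proof -
  obtain h where hm: "h \<in> borel_measurable borel" and nn: "\<And>x. 0 \<le> h x" and bv: "bounded_variation01 h"
    and hi: "integrable unit_lborel h" and h1: "(\<integral>x. h x \<partial>unit_lborel) = 1"
    and inv: "\<And>E. E \<in> sets unit_lborel \<Longrightarrow>
      (\<integral>u. (p * indicator E (gauss_map u) + (1 - p) * indicator E (renyi_map u)) * h u \<partial>unit_lborel) =
      (\<integral>u. indicator E u * h u \<partial>unit_lborel)"
    using ex_invariant_bv_density[OF assms] by blast
  note [measurable] = measurable_unit_lborelI[OF hm]
  define \<mu> where "\<mu> = density unit_lborel (\<lambda>x. ennreal (h x))"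
  have S: "sets \<mu> = sets unit_lborel" by (simp add: \<mu>_def)
  have ih: "integrable unit_lborel (\<lambda>x. indicator E x * h x)" if "E \<in> sets unit_lborel" for E
    using integrable_mult_indicator[OF that hi] by simp
  have em: "emeasure \<mu> E = ennreal (\<integral>x. indicator E x * h x \<partial>unit_lborel)" if E: "E \<in> sets unit_lborel" for E
  proof -
    have "emeasure \<mu> E = (\<integral>\<^sup>+x. ennreal (indicator E x * h x) \<partial>unit_lborel)"
      unfolding \<mu>_def using E
      by (subst emeasure_density) (auto intro!: nn_integral_cong split: split_indicator)
    also have "\<dots> = ennreal (\<integral>x. indicator E x * h x \<partial>unit_lborel)"
      by (rule nn_integral_eq_integral[OF ih[OF E]]) (simp add: nn)
    finally show ?thesis .
  qed
  have P: "prob_space \<mu>"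
  proof (rule prob_spaceI)
    have "emeasure \<mu> (space \<mu>) = (\<integral>\<^sup>+x. ennreal (h x) \<partial>unit_lborel)"
      unfolding \<mu>_def using sets.top[of unit_lborel]
      by (subst emeasure_density) (auto intro!: nn_integral_cong)
    also have "\<dots> = ennreal 1"
      unfolding h1[symmetric] by (rule nn_integral_eq_integral[OF hi]) (simp add: nn)
    finally show "emeasure \<mu> (space \<mu>) = 1" by simp
  qed
  have "invariant_measure (bernoulli_measure p \<Otimes>\<^sub>M \<mu>) skew_product"
  proof (rule invariant_skew_productI[OF P S assms])
    fix E assume "E \<in> sets \<mu>"
    then have E: "E \<in> sets unit_lborel" by (simp add: S)
    let ?G = "gauss_map -` E \<inter> {0..1}" and ?R = "renyi_map -` E \<inter> {0..1}"
    have GR: "?G \<in> sets unit_lborel" "?R \<in> sets unit_lborel"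
      using measurable_sets[OF gauss_map_measurable E] measurable_sets[OF renyi_map_measurable E] by auto
    have "ennreal p * emeasure \<mu> ?G + ennreal (1 - p) * emeasure \<mu> ?R =
      ennreal (p * (\<integral>x. indicator ?G x * h x \<partial>unit_lborel) + (1 - p) * (\<integral>x. indicator ?R x * h x \<partial>unit_lborel))"
      using assms nn by (simp add: em GR ennreal_mult' ennreal_plus integral_nonneg_AE)
    also have "p * (\<integral>x. indicator ?G x * h x \<partial>unit_lborel) + (1 - p) * (\<integral>x. indicator ?R x * h x \<partial>unit_lborel) =
      (\<integral>x. p * (indicator ?G x * h x) + (1 - p) * (indicator ?R x * h x) \<partial>unit_lborel)"
      using ih[OF GR(1)] ih[OF GR(2)] by simp
    \<comment> \<open>On the unit interval the indicator of a preimage is the indicator of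
      \<open>E\<close> composed with the map.\<close>
    also have "\<dots> = (\<integral>u. (p * indicator E (gauss_map u) + (1 - p) * indicator E (renyi_map u)) * h u \<partial>unit_lborel)"
      by (intro Bochner_Integration.integral_cong) (auto simp: algebra_simps split: split_indicator)
    finally show "ennreal p * emeasure \<mu> ?G + ennreal (1 - p) * emeasure \<mu> ?R = emeasure \<mu> E"
      by (simp add: inv[OF E] em[OF E])
  qed
  moreover have "absolutely_continuous unit_lborel \<mu>"
    unfolding \<mu>_def by (rule absolutely_continuousI_density) measurable
  moreover have "is_density_of h \<mu>"
    by (simp add: is_density_of_def \<mu>_def nn measurable_unit_lborelI[OF hm])
  moreover have "has_bounded_variation_version h"
    using bv by (auto simp: has_bounded_variation_version_def)
  ultimately show ?thesis using P S by blast
qed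

end
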